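(* Let $a\in(0,1)$ and let $P(z) = (z-a)\prod_{j=1}^{n-1}(z-z_j)$ be a polynomial of degree $n$ that contradicts Sendov's conjecture at $a$. Put $\gamma(a) = 0.1a+0.9$, $c = a\gamma(a)$, $p' = \frac{a/4}{1-a/2}$, $q' = \frac{a/4}{1+a/2}$, $$r = \frac{c(a-c)}{2(1-c^2)},\qquad \alpha = \frac{\log ( a/16 )}{\log \left( \frac{c+r}{1+cr} \right)},$$ $$K' = \min \left\{ (1+c-ac)^{p'} \left(\sqrt{1+c^2-ac}\right)^{1-p'},\ (1+c)^{q'} \left(\sqrt{1+c^2-ac}\right)^{1-q'} \right\}.$$ Let $\mathcal{N}_0(a) = \frac{32 \log ( 40/a^2 )}{a^2}$ and $\mathcal{N}_1(a) = \max \left \{ 9 \left( \frac{4+2a}{a} \right)^2 , \mathcal{N}_0(a) \right \}$. If $n \geq \mathcal{N}_1(a)$, then $$|P(c)|\geq \frac{(1-c)(a-c)}{1-ac}\, r^\alpha\, {K'}^{\,n-1}.$$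
   Context: A polynomial $P(z) = (z-a)\prod_{j=1}^{n-1}(z-z_j)$ with $a\in(0,1)$ and $|z_j|\le 1$ for all $j$ is said to contradict Sendov's conjecture at $a$ if every zero $w$ of $P'$ satisfies $|w-a|>1$. *)

theory Defs
  imports "HOL-Analysis.Analysis" "HOL-Computational_Algebra.Polynomial"
begin

definition sendov_poly :: "real \<Rightarrow> (nat \<Rightarrow> complex) \<Rightarrow> nat \<Rightarrow> complex poly" where
  "sendov_poly a zs n = [:- complex_of_real a, 1:] * (\<Prod>j\<in>{1..n-1}. [:- zs j, 1:])"

definition contradicts_sendov :: "real \<Rightarrow> (nat \<Rightarrow> complex) \<Rightarrow> nat \<Rightarrow> bool" where
  "contradicts_sendov a zs n \<longleftrightarrow>
     0 < a \<and> a < 1 \<and> (\<forall>j\<in>{1..n-1}. cmod (zs j) \<le> 1) \<and>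
     (\<forall>w. poly (pderiv (sendov_poly a zs n)) w = 0 \<longrightarrow> cmod (w - complex_of_real a) > 1)"

definition gam :: "real \<Rightarrow> real" where "gam a = 0.1 * a + 0.9"
definition cc :: "real \<Rightarrow> real" where "cc a = a * gam a"
definition p' :: "real \<Rightarrow> real" where "p' a = (a / 4) / (1 - a / 2)"
definition q' :: "real \<Rightarrow> real" where "q' a = (a / 4) / (1 + a / 2)"
definition rr :: "real \<Rightarrow> real" where
  "rr a = cc a * (a - cc a) / (2 * (1 - (cc a)^2))"
definition alph :: "real \<Rightarrow> real" where
  "alph a = ln (a / 16) / ln ((cc a + rr a) / (1 + cc a * rr a))"
definition K' :: "real \<Rightarrow> real" where
  "K' a = min ((1 + cc a - a * cc a) powr (p' a) * (sqrt (1 + (cc a)^2 - a * cc a)) powr (1 - p' a))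
              ((1 + cc a) powr (q' a) * (sqrt (1 + (cc a)^2 - a * cc a)) powr (1 - q' a))"
definition N0 :: "real \<Rightarrow> real" where "N0 a = 32 * ln (40 / a^2) / a^2"
definition N1 :: "real \<Rightarrow> real" where "N1 a = max (9 * ((4 + 2 * a) / a)^2) (N0 a)"

end

theory Submission
  imports Defs "HOL-Computational_Algebra.Fundamental_Theorem_Algebra"
begin

text \<open>
  By Gauss--Lucas the critical points \<open>w\<^sub>j\<close> lie in the lune \<open>\<bar>w\<bar> \<le> 1 < \<bar>w - a\<bar>\<close>, so \<open>Re w\<^sub>j \<le> a/2\<close>.
  If all \<open>w\<^sub>j\<close> are closer to \<open>b\<close> than to \<open>a\<close> by a factor \<open>\<rho> < 1\<close>, the Grace--Walsh--Szego theorem applied to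
  the functional \<open>Q \<mapsto> n \<integral>\<^sub>a\<^sup>b Q - \<mu> Q(a)\<close> bounds \<open>\<bar>P(b)\<bar>\<close> below. At \<open>b = a/4\<close> this forces the mean of
  \<open>Re w\<^sub>j\<close>, which is the mean of the real parts of all zeros, to be at most \<open>a/4\<close>, since otherwise \<open>P(a/4)\<close> would
  be exponentially small; then \<open>P'\<close> is exponentially small on \<open>[0, a/4]\<close> relative to \<open>P'(a)\<close>, so \<open>P(0)\<close> is
  close to \<open>P(a/4)\<close> and \<open>\<Prod>\<bar>z\<^sub>j\<bar> \<ge> a/16\<close>. The same bound shows that \<open>P\<close> has no zero in the pseudohyperbolic
  disc of radius \<open>r\<close> around \<open>c\<close>.

  Write \<open>\<bar>P(c)\<bar> = (a - c) \<Prod>\<rho>\<^sub>j \<Prod>\<bar>1 - c z\<^sub>j\<bar>\<close> with \<open>\<rho>\<^sub>j\<close> the pseudohyperbolic distance of \<open>c\<close> and \<open>z\<^sub>j\<close>.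
  The bounds \<open>\<rho>\<^sub>j \<ge> r\<close>, \<open>\<bar>z\<^sub>j\<bar> \<le> (c + \<rho>\<^sub>j)/(1 + c \<rho>\<^sub>j)\<close> and \<open>\<Prod>\<bar>z\<^sub>j\<bar> \<ge> a/16\<close> give \<open>\<Prod>\<rho>\<^sub>j \<ge> r\<^sup>\<alpha>\<close> by
  concavity. Comparing \<open>P\<close> with \<open>P'\<close> at \<open>1/c\<close> replaces the zeros in the last product by the critical points at
  the cost of \<open>1 - c\<close>, and \<open>ln \<bar>1 - c w\<bar>\<close> is bounded below on the lune by an affine function of \<open>Re w\<close> whose
  value at \<open>a/4\<close> is \<open>ln K'\<close>.
\<close>

subsection \<open>The Grace--Walsh--Szego theorem for discs\<close>

lemma poly_pderiv_prod_linear: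
  fixes z :: "nat \<Rightarrow> complex"
  assumes "finite A" "\<And>k. k \<in> A \<Longrightarrow> w \<noteq> z k"
  shows "poly (pderiv (\<Prod>k\<in>A. [:- z k, 1:])) w
           = poly (\<Prod>k\<in>A. [:- z k, 1:]) w * (\<Sum>k\<in>A. 1 / (w - z k))"
proof -
  have "poly (\<Prod>j\<in>A - {k}. [:- z j, 1:]) w = poly (\<Prod>j\<in>A. [:- z j, 1:]) w * (1 / (w - z k))"
    if "k \<in> A" for k
  proof -
    have "poly (\<Prod>j\<in>A. [:- z j, 1:]) w = (w - z k) * poly (\<Prod>j\<in>A - {k}. [:- z j, 1:]) w"
      using assms(1) that by (simp add: prod.remove[of A k] algebra_simps)
    with assms(2)[OF that] show ?thesis
      by simp
  qed
  then show ?thesis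
    by (simp add: pderiv_prod poly_sum pderiv_pCons sum_distrib_left cong: sum.cong)
qed

lemma coeff_prod_linear_subleading:
  fixes z :: "nat \<Rightarrow> 'a::comm_ring_1"
  assumes "n > 0"
  shows "coeff (\<Prod>k<n. [:- z k, 1:]) (n - 1) = - (\<Sum>k<n. z k)"
proof -
  have lead: "coeff (\<Prod>k<m. [:- z k, 1:]) m = 1" for m
  proof (induction m)
    case (Suc m)
    have "coeff (\<Prod>k<m. [:- z k, 1:]) (Suc m) = 0"
    proof (rule coeff_eq_0)
      have "degree (\<Prod>k<m. [:- z k, 1:]) \<le> (\<Sum>k<m. degree [:- z k, 1:])"
        by (rule degree_prod_sum_le[unfolded o_def]) simp
      also have "\<dots> = m"
        by simp
      finally show "degree (\<Prod>k<m. [:- z k, 1:]) < Suc m"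
        by simp
    qed
    with Suc show ?case
      by simp
  qed simp
  have "coeff (\<Prod>k<Suc m. [:- z k, 1:]) m = - (\<Sum>k<Suc m. z k)" for m
  proof (induction m)
    case (Suc m)
    have "coeff (\<Prod>k<Suc (Suc m). [:- z k, 1:]) (Suc m)
        = - z (Suc m) * coeff (\<Prod>k<Suc m. [:- z k, 1:]) (Suc m) + coeff (\<Prod>k<Suc m. [:- z k, 1:]) m"
      by (subst prod.lessThan_Suc) (simp only: mult_pCons_right coeff_add coeff_smult coeff_pCons_Suc, simp)
    then show ?case
      using Suc lead[of "Suc m"] by simp
  qed simp
  from this[of "n - 1"] assms show ?thesis
    by simp
qed

text \<open>The map \<open>z \<mapsto> 1 / (w - z)\<close> sends the exterior of a disc containing \<open>w\<close>, together with
  infinity, onto a convex set, which therefore contains every average of the image points.\<close>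

lemma laguerre_disc:
  fixes p :: "complex poly"
  assumes deg: "degree p \<le> m" and m: "m > 0"
    and nz: "\<And>z. z \<in> cball c R \<Longrightarrow> poly p z \<noteq> 0"
    and w: "w \<in> cball c R" and u: "u \<in> cball c R"
  shows "of_nat m * poly p w \<noteq> (w - u) * poly (pderiv p) w"
proof
  assume eq: "of_nat m * poly p w = (w - u) * poly (pderiv p) w"
  obtain z where dec: "smult (lead_coeff p) (\<Prod>i<degree p. [:- z i, 1:]) = p"
    by (rule complex_poly_decompose')
  let ?d = "degree p"
  have pw: "poly p w \<noteq> 0"
    using nz w by blast
  have zout: "z i \<notin> cball c R" if "i < ?d" for i
  proof
    assume "z i \<in> cball c R"
    moreover have "poly p (z i) = 0"
      using that by (subst dec[symmetric]) (auto simp: poly_prod)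
    ultimately show False
      using nz by blast
  qed
  define S where "S = (\<Sum>i<?d. 1 / (w - z i))"
  have "poly (pderiv p) w = poly p w * S"
  proof -
    have "poly (pderiv (\<Prod>i<?d. [:- z i, 1:])) w = poly (\<Prod>i<?d. [:- z i, 1:]) w * S"
      unfolding S_def using zout w by (intro poly_pderiv_prod_linear) auto
    then have "poly (pderiv (smult (lead_coeff p) (\<Prod>i<?d. [:- z i, 1:]))) w
        = poly (smult (lead_coeff p) (\<Prod>i<?d. [:- z i, 1:])) w * S"
      by (simp add: pderiv_smult)
    then show ?thesis
      unfolding dec .
  qed
  with eq have "poly p w * of_nat m = poly p w * ((w - u) * S)"
    by (simp add: mult_ac)
  with pw have mS: "of_nat m = (w - u) * S"
    by simp
  with m have wu: "w \<noteq> u"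
    by auto
  define T where "T = R\<^sup>2 - (cmod (w - c))\<^sup>2"
  have T0: "T \<ge> 0"
  proof -
    have "cmod (w - c) \<le> R"
      using w by (simp add: dist_norm norm_minus_commute)
    then show ?thesis
      by (simp add: T_def power_mono)
  qed
  \<comment> \<open>The condition \<open>g y < 1\<close> describes the image of the exterior of the
    disc under v -> 1 / (w - v). Since \<open>T\<close> is nonnegative, \<open>g\<close> is convex,
    so the strict bound passes to averages of image points.\<close>
  define g where "g y = 2 * Re ((w - c) * y) + T * (cmod y)\<^sup>2" for y
  have key: "((cmod (v - c))\<^sup>2 - R\<^sup>2) * (cmod y)\<^sup>2 = 1 - g y" if "y = 1 / (w - v)" "v \<noteq> w" for v y
  proof -
    have "(v - c) * y = (w - c) * y - 1"
      using that by (simp add: field_simps)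
    then have "(cmod (v - c))\<^sup>2 * (cmod y)\<^sup>2 = (cmod ((w - c) * y - 1))\<^sup>2"
      by (metis norm_mult power_mult_distrib)
    also have "\<dots> = (cmod (w - c))\<^sup>2 * (cmod y)\<^sup>2 - 2 * Re ((w - c) * y) + 1"
      by (simp add: cmod_power2) (simp add: power2_eq_square algebra_simps)
    finally show ?thesis
      by (simp add: g_def T_def algebra_simps)
  qed
  have gz: "g (1 / (w - z i)) < 1" if "i < ?d" for i
  proof -
    have "z i \<noteq> w" "cmod (z i - c) > R"
      using zout[OF that] w by (auto simp: dist_norm norm_minus_commute)
    moreover have "R \<ge> 0"
      using w by (metis cball_eq_empty empty_iff not_less)
    ultimately have "((cmod (z i - c))\<^sup>2 - R\<^sup>2) * (cmod (1 / (w - z i)))\<^sup>2 > 0"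
      by (intro mult_pos_pos) (auto simp: power_strict_mono)
    with key[OF refl \<open>z i \<noteq> w\<close>] show ?thesis
      by simp
  qed
  have "g (1 / (w - u)) \<ge> 1"
  proof -
    have "cmod (u - c) \<le> R"
      using u by (simp add: dist_norm norm_minus_commute)
    then have "(cmod (u - c))\<^sup>2 \<le> R\<^sup>2"
      by (simp add: power_mono)
    then have "((cmod (u - c))\<^sup>2 - R\<^sup>2) * (cmod (1 / (w - u)))\<^sup>2 \<le> 0"
      by (simp add: mult_nonpos_nonneg)
    with key[of "1 / (w - u)" u] wu show ?thesis
      by simp
  qed
  moreover have "1 / (w - u) = S / of_nat m"
    using mS wu m by (simp add: field_simps)
  ultimately have "real m \<le> real m * g (S / of_nat m)"
    using m by simp
  also have "\<dots> = 2 * Re ((w - c) * S) + T * ((cmod S)\<^sup>2 / m)"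
  proof -
    have "Re ((w - c) * (S / of_nat m)) = Re ((w - c) * S) / m"
      by (metis Re_divide_of_nat times_divide_eq_right)
    moreover have "(cmod (S / of_nat m))\<^sup>2 = (cmod S)\<^sup>2 / m / m"
      by (simp add: norm_divide power_divide power2_eq_square)
    ultimately show ?thesis
      using m by (simp add: g_def field_simps)
  qed
  \<comment> \<open>Cauchy-Schwarz over at most \<open>m\<close> terms. If the degree is below
    \<open>m\<close>, the missing roots count as roots at infinity, whose image point is 0.\<close>
  also have "\<dots> \<le> 2 * Re ((w - c) * S) + T * (\<Sum>i<?d. (cmod (1 / (w - z i)))\<^sup>2)"
  proof -
    have "(cmod S)\<^sup>2 \<le> (\<Sum>i<?d. cmod (1 / (w - z i)))\<^sup>2"
      unfolding S_def by (intro power_mono norm_sum) auto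
    also have "\<dots> \<le> (\<Sum>i<?d. (cmod (1 / (w - z i)))\<^sup>2) * card {..<?d}"
      by (rule sum_squared_le_sum_of_squares)
    also have "\<dots> \<le> (\<Sum>i<?d. (cmod (1 / (w - z i)))\<^sup>2) * m"
      using deg by (intro mult_left_mono sum_nonneg) auto
    finally have "(cmod S)\<^sup>2 / m \<le> (\<Sum>i<?d. (cmod (1 / (w - z i)))\<^sup>2)"
      using m by (simp add: divide_le_eq)
    from mult_left_mono[OF this T0] show ?thesis
      by simp
  qed
  also have "\<dots> = (\<Sum>i<?d. g (1 / (w - z i)))"
    by (simp only: g_def S_def sum_distrib_left Re_sum sum.distrib)
  also have "\<dots> < m"
  proof (cases "?d = 0")
    case False
    then have "(\<Sum>i<?d. g (1 / (w - z i))) < (\<Sum>i<?d. 1)"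
      by (intro sum_strict_mono gz) auto
    with deg show ?thesis
      by simp
  qed (use m in simp)
  finally show False
    by simp
qed

lemma linear_power_eq_sum_monom:
  fixes w :: "'a::comm_ring_1"
  shows "[:- w, 1:] ^ m = (\<Sum>k\<le>m. smult (of_nat (m choose k) * (- w) ^ k) (monom 1 (m - k)))"
proof -
  have "[:- w, 1:] ^ m = ([:- w:] + monom 1 1) ^ m"
    by (simp add: monom_altdef)
  also have "\<dots> = (\<Sum>k\<le>m. of_nat (m choose k) * [:- w:] ^ k * monom 1 1 ^ (m - k))"
    by (rule binomial_ring)
  also have "\<dots> = (\<Sum>k\<le>m. smult (of_nat (m choose k) * (- w) ^ k) (monom 1 (m - k)))"
    by (intro sum.cong refl) (simp add: poly_const_pow monom_power of_nat_poly smult_smult mult_ac)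
  finally show ?thesis .
qed

text \<open>The Grace--Walsh--Szego coincidence theorem, in the form in which it is applied. The factors are
  replaced one at a time, each replacement being a polar derivative to which Laguerre's theorem applies.\<close>

lemma walsh_nonvanishing:
  fixes L :: "complex poly \<Rightarrow> complex"
  assumes "R \<ge> 0"
    and "\<And>p q. L (p + q) = L p + L q" "\<And>c p. L (smult c p) = c * L p"
    and "\<And>w. w \<in> cball c R \<Longrightarrow> L ([:- w, 1:] ^ m) \<noteq> 0"
    and "\<And>j. j < m \<Longrightarrow> w j \<in> cball c R"
  shows "L (\<Prod>j<m. [:- w j, 1:]) \<noteq> 0"
  using assms(2-)
proof (induction m arbitrary: L)
  case 0
  from "0.prems"(3)[of c] \<open>R \<ge> 0\<close> show ?case
    by simp
next
  case (Suc m)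
  note add = Suc.prems(1) and smult = Suc.prems(2)
  have L0: "L 0 = 0"
    using smult[of 0 0] by simp
  have Lsum: "L (\<Sum>i\<in>A. f i) = (\<Sum>i\<in>A. L (f i))" for A :: "nat set" and f
    by (induction A rule: infinite_finite_induct) (simp_all add: L0 add)
  \<comment> \<open>This is the polynomial v -> L ((X - v)^(m+1)), expanded by the binomial theorem;
    by hypothesis it has no zero in the disc.\<close>
  define p where "p = (\<Sum>k\<le>Suc m. monom (of_nat (Suc m choose k) * (- 1) ^ k * L (monom 1 (Suc m - k))) k)"
  have deg: "degree p \<le> Suc m"
    unfolding p_def by (intro degree_sum_le) (auto intro: order.trans[OF degree_monom_le])
  have poly_p: "poly p v = L ([:- v, 1:] ^ Suc m)" for v
    unfolding linear_power_eq_sum_monom Lsum smult p_def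
    by (simp add: poly_sum poly_monom power_minus[of v] mult_ac del: sum.atMost_Suc binomial_Suc_Suc)
  have poly_p': "poly (pderiv p) v = - of_nat (Suc m) * L ([:- v, 1:] ^ m)" for v
  proof -
    have "poly (pderiv p) v = (\<Sum>k\<le>Suc m. of_nat k * of_nat (Suc m choose k) * (- 1) ^ k
        * L (monom 1 (Suc m - k)) * v ^ (k - 1))"
      unfolding p_def higher_pderiv_sum[of 1, simplified]
      by (simp add: poly_sum pderiv_monom poly_monom mult_ac del: sum.atMost_Suc binomial_Suc_Suc)
    also have "\<dots> = (\<Sum>k\<le>m. of_nat (Suc k) * of_nat (Suc m choose Suc k) * (- 1) ^ Suc k
        * L (monom 1 (m - k)) * v ^ k)"
      by (subst sum.atMost_Suc_shift) simp
    also have "\<dots> = (\<Sum>k\<le>m. - of_nat (Suc m) * (of_nat (m choose k) * (- v) ^ k * L (monom 1 (m - k))))"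
    proof (intro sum.cong refl)
      fix k
      have "of_nat (Suc k) * of_nat (Suc m choose Suc k) = (of_nat (Suc m) * of_nat (m choose k) :: complex)"
        using arg_cong[OF Suc_times_binomial_eq[of m k], of complex_of_nat]
        by (simp only: of_nat_mult mult.commute)
      then show "of_nat (Suc k) * of_nat (Suc m choose Suc k) * (- 1) ^ Suc k * L (monom 1 (m - k)) * v ^ k
          = - of_nat (Suc m) * (of_nat (m choose k) * (- v) ^ k * L (monom 1 (m - k)))"
        by (simp only: power_minus[of v]) (simp only: power_Suc, simp only: mult_ac mult_minus_left mult_minus_right mult_1_left)
    qed
    also have "\<dots> = - of_nat (Suc m) * L ([:- v, 1:] ^ m)"
      unfolding linear_power_eq_sum_monom Lsum smult by (simp only: sum_distrib_left)
    finally show ?thesis .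
  qed
  define L1 where "L1 q = L ([:- w m, 1:] * q)" for q
  have "L1 (\<Prod>j<m. [:- w j, 1:]) \<noteq> 0"
  proof (rule Suc.IH)
    show "L1 (q + q') = L1 q + L1 q'" for q q'
      by (simp only: L1_def distrib_left add)
    show "L1 (smult a q) = a * L1 q" for a q
      by (simp only: L1_def mult_smult_right smult)
    show "w j \<in> cball c R" if "j < m" for j
      using Suc.prems(4) that by simp
    fix v
    assume v: "v \<in> cball c R"
    \<comment> \<open>Up to the factor m + 1, L1 ((X - v)^m) is the polar derivative of
      \<open>p\<close> with pole \<open>w m\<close>, so Laguerre's theorem keeps it away from
      0.\<close>
    have "[:- w m, 1:] = [:- v, 1:] + [:v - w m:]"
      by simp
    then have "[:- w m, 1:] * [:- v, 1:] ^ m = [:- v, 1:] ^ Suc m + smult (v - w m) ([:- v, 1:] ^ m)"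
      by (simp only: distrib_right power_Suc) simp
    then have "L1 ([:- v, 1:] ^ m) = L ([:- v, 1:] ^ Suc m) + (v - w m) * L ([:- v, 1:] ^ m)"
      by (simp only: L1_def add smult)
    then have "of_nat (Suc m) * L1 ([:- v, 1:] ^ m)
        = of_nat (Suc m) * poly p v - (v - w m) * poly (pderiv p) v"
      by (simp only: poly_p poly_p' distrib_left minus_mult_left[symmetric] mult_minus_right diff_minus_eq_add mult.left_commute)
    moreover have "of_nat (Suc m) * poly p v \<noteq> (v - w m) * poly (pderiv p) v"
      using Suc.prems(3,4) v deg by (intro laguerre_disc[where c = c and R = R]) (auto simp: poly_p simp del: power_Suc)
    ultimately show "L1 ([:- v, 1:] ^ m) \<noteq> 0"
      by auto
  qed
  then show ?case
    by (simp add: L1_def mult.commute)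
qed

section \<open>Lower bounds for a polynomial from the position of its critical points\<close>

lemma has_integral_poly_pderiv_segment:
  fixes F :: "complex poly"
  shows "((\<lambda>t. (b - a) * poly (pderiv F) (a + of_real t * (b - a))) has_integral (poly F b - poly F a)) {0..1}"
proof -
  have "((\<lambda>t. poly F (a + of_real t * (b - a))) has_vector_derivative
      (b - a) * poly (pderiv F) (a + of_real x * (b - a))) (at x within {0..1})" for x
    by (rule has_vector_derivative_real_field)
      (auto intro!: derivative_eq_intros DERIV_chain2[OF poly_DERIV])
  from fundamental_theorem_of_calculus[OF _ this] show ?thesis
    by simp
qed

text \<open>A bounded ratio of distances to two points cuts out an Apollonius disc. The explicit
  centre and radius bring the distance hypotheses into the form required by
  \<open>walsh_nonvanishing\<close>.\<close>

lemma apollonius_disc: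
  fixes a b v :: complex
  assumes "0 \<le> \<rho>" "\<rho> < 1"
  shows "v \<in> cball ((b - of_real (\<rho>\<^sup>2) * a) / of_real (1 - \<rho>\<^sup>2)) (\<rho> * cmod (b - a) / (1 - \<rho>\<^sup>2))
           \<longleftrightarrow> cmod (b - v) \<le> \<rho> * cmod (a - v)"
proof -
  define k where "k = 1 - \<rho>\<^sup>2"
  have k: "k > 0"
    using assms by (simp add: k_def power_less_one_iff)
  define c where "c = (b - of_real (\<rho>\<^sup>2) * a) / of_real k"
  have kc: "of_real k * (c - v) = b - of_real (\<rho>\<^sup>2) * a - of_real k * v"
    using k by (simp add: c_def field_simps)
  have "v \<in> cball c (\<rho> * cmod (b - a) / k) \<longleftrightarrow> k * cmod (c - v) \<le> \<rho> * cmod (b - a)"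
    using k by (simp add: dist_norm field_simps)
  also have "k * cmod (c - v) = cmod (b - of_real (\<rho>\<^sup>2) * a - of_real k * v)"
    using k by (simp only: kc[symmetric] norm_mult norm_of_real)
  also have "\<dots> \<le> \<rho> * cmod (b - a) \<longleftrightarrow>
      (cmod (b - of_real (\<rho>\<^sup>2) * a - of_real k * v))\<^sup>2 - (\<rho> * cmod (b - a))\<^sup>2 \<le> 0"
    using assms by (simp add: power2_le_iff_abs_le abs_mult)
  also have "(cmod (b - of_real (\<rho>\<^sup>2) * a - of_real k * v))\<^sup>2 - (\<rho> * cmod (b - a))\<^sup>2
      = k * ((cmod (b - v))\<^sup>2 - (\<rho> * cmod (a - v))\<^sup>2)"
    unfolding k_def power_mult_distrib cmod_power2 by simp algebra
  also have "\<dots> \<le> 0 \<longleftrightarrow> cmod (b - v) \<le> \<rho> * cmod (a - v)"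
    using assms k by (simp add: mult_le_0_iff power2_le_iff_abs_le abs_mult)
  finally show ?thesis
    by (simp add: c_def k_def)
qed

text \<open>The functional \<open>L\<close> with \<mu> = P(b) / D, where D = P'(a) / n, vanishes on
  P' / n because P(a) = 0. On (X - v)^(n-1) it equals (b - v)^n - (a - v)^n - \<mu> (a - v)^(n-1),
  which cannot vanish on the Apollonius disc if P(b) is too small. This contradicts the coincidence
  theorem.\<close>

lemma poly_lower_bound_from_critical_points:
  fixes P :: "complex poly"
  assumes P': "pderiv P = smult (of_nat n) (\<Prod>j<n - 1. [:- w j, 1:])"
    and Pa: "poly P a = 0" and n: "n > 0" and \<rho>: "0 \<le> \<rho>" "\<rho> < 1"
    and closer: "\<And>j. j < n - 1 \<Longrightarrow> cmod (b - w j) \<le> \<rho> * cmod (a - w j)"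
  shows "(1 - \<rho> ^ n) / (1 + \<rho>) * cmod (b - a) * (\<Prod>j<n - 1. cmod (a - w j)) \<le> cmod (poly P b)"
proof (rule ccontr)
  assume neg: "\<not> ?thesis"
  define D where "D = poly (\<Prod>j<n - 1. [:- w j, 1:]) a"
  have norm_D: "cmod D = (\<Prod>j<n - 1. cmod (a - w j))"
    by (simp add: D_def poly_prod prod_norm)
  have D0: "D \<noteq> 0"
    using neg unfolding norm_D[symmetric] by auto
  define \<mu> where "\<mu> = poly P b / D"
  have \<mu>: "cmod \<mu> < (1 - \<rho> ^ n) / (1 + \<rho>) * cmod (b - a)"
    using neg D0 unfolding norm_D[symmetric] by (simp add: \<mu>_def norm_divide divide_less_eq)
  define L where "L q = of_nat n * integral {0..1} (\<lambda>t. (b - a) * poly q (a + of_real t * (b - a))) - \<mu> * poly q a"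
    for q :: "complex poly"
  have int: "(\<lambda>t. (b - a) * poly q (a + of_real t * (b - a))) integrable_on {0..1}" for q :: "complex poly"
    by (intro integrable_continuous_interval continuous_intros)
  have L_eq: "L q = poly F b - poly F a - \<mu> * poly q a" if "pderiv F = smult (of_nat n) q" for F q
  proof -
    have "((\<lambda>t. of_nat n * ((b - a) * poly q (a + of_real t * (b - a)))) has_integral poly F b - poly F a) {0..1}"
      using has_integral_poly_pderiv_segment[of b a F] by (simp add: that mult_ac)
    then show ?thesis
      by (simp add: L_def integral_unique flip: integral_mult_right)
  qed
  have "L (\<Prod>j<n - 1. [:- w j, 1:]) \<noteq> 0"
  proof (rule walsh_nonvanishing)
    show "L (p + q) = L p + L q" for p q
      by (simp add: L_def distrib_left integral_add[OF int int])
    show "L (smult c q) = c * L q" for c q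
      using integral_mult_right[of "{0..1}" c "\<lambda>t. (b - a) * poly q (a + of_real t * (b - a))"]
      by (simp add: L_def algebra_simps)
    show "w j \<in> cball ((b - of_real (\<rho>\<^sup>2) * a) / of_real (1 - \<rho>\<^sup>2)) (\<rho> * cmod (b - a) / (1 - \<rho>\<^sup>2))"
      if "j < n - 1" for j
      using closer[OF that] apollonius_disc[OF \<rho>] by blast
    show "0 \<le> \<rho> * cmod (b - a) / (1 - \<rho>\<^sup>2)"
      using \<rho> by (simp add: power_le_one)
    fix v
    assume "v \<in> cball ((b - of_real (\<rho>\<^sup>2) * a) / of_real (1 - \<rho>\<^sup>2)) (\<rho> * cmod (b - a) / (1 - \<rho>\<^sup>2))"
    then have v: "cmod (b - v) \<le> \<rho> * cmod (a - v)"
      using apollonius_disc[OF \<rho>] by blast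
    show "L ([:- v, 1:] ^ (n - 1)) \<noteq> 0"
    proof
      assume L0: "L ([:- v, 1:] ^ (n - 1)) = 0"
      have "pderiv ([:- v, 1:] ^ n) = smult (of_nat n) ([:- v, 1:] ^ (n - 1))"
        using n by (cases n) (simp_all only: pderiv_power_Suc, simp_all add: pderiv_pCons)
      from L_eq[OF this] L0 have "\<mu> * (a - v) ^ (n - 1) = (b - v) ^ n - (a - v) ^ n"
        by simp
      then have "cmod \<mu> * cmod (a - v) ^ (n - 1) = cmod ((b - v) ^ n - (a - v) ^ n)"
        by (metis norm_mult norm_power)
      also have "\<dots> \<ge> cmod (a - v) ^ n - cmod (b - v) ^ n"
        by (metis norm_minus_commute norm_power norm_triangle_ineq2)
      also have "cmod (a - v) ^ n - cmod (b - v) ^ n \<ge> cmod (a - v) ^ n - (\<rho> * cmod (a - v)) ^ n"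
        using v by (simp add: power_mono)
      also have "cmod (a - v) ^ n - (\<rho> * cmod (a - v)) ^ n
          = ((1 - \<rho> ^ n) * cmod (a - v)) * cmod (a - v) ^ (n - 1)"
        using n by (cases n) (simp_all add: power_mult_distrib algebra_simps)
      finally have ge: "((1 - \<rho> ^ n) * cmod (a - v)) * cmod (a - v) ^ (n - 1)
          \<le> cmod \<mu> * cmod (a - v) ^ (n - 1)" .
      \<comment> \<open>Source of the denominator 1 + \<rho>: the triangle inequality through
        \<open>v\<close>.\<close>
      have tri: "cmod (b - a) \<le> (1 + \<rho>) * cmod (a - v)"
        using norm_triangle_ineq4[of "b - v" "a - v"] v by (simp add: algebra_simps)
      have "cmod (b - a) \<noteq> 0"
        using \<mu> by auto
      with tri \<rho> have "cmod (a - v) > 0"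
        by (cases "cmod (a - v) = 0") auto
      with ge have "(1 - \<rho> ^ n) * cmod (a - v) \<le> cmod \<mu>"
        by simp
      moreover have "(1 - \<rho> ^ n) / (1 + \<rho>) * cmod (b - a) \<le> (1 - \<rho> ^ n) * cmod (a - v)"
      proof -
        have "cmod (b - a) / (1 + \<rho>) \<le> cmod (a - v)"
          using tri \<rho> by (simp add: divide_le_eq mult.commute)
        moreover have "0 \<le> 1 - \<rho> ^ n"
          using \<rho> by (simp add: power_le_one)
        ultimately show ?thesis
          using mult_left_mono by fastforce
      qed
      ultimately show False
        using \<mu> by simp
    qed
  qed
  moreover have "L (\<Prod>j<n - 1. [:- w j, 1:]) = 0"
    using L_eq[OF P'] D0 by (simp add: Pa \<mu>_def D_def)
  ultimately show False
    by blast
qed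

subsection \<open>The lens of the zeros and the lune of the critical points\<close>

text \<open>If |w| > 1, every w / (w - z_k) has positive real part, so the logarithmic derivative
  cannot vanish at w.\<close>

lemma gauss_lucas_unit_disc:
  fixes z :: "nat \<Rightarrow> complex"
  assumes A: "finite A" "A \<noteq> {}" and z: "\<And>k. k \<in> A \<Longrightarrow> cmod (z k) \<le> 1"
    and crit: "poly (pderiv (\<Prod>k\<in>A. [:- z k, 1:])) w = 0"
  shows "cmod w \<le> 1"
proof (rule ccontr)
  assume "\<not> cmod w \<le> 1"
  then have w: "cmod w > 1"
    by simp
  have wz: "w \<noteq> z k" if "k \<in> A" for k
    using z[OF that] w by auto
  have "poly (\<Prod>k\<in>A. [:- z k, 1:]) w \<noteq> 0"
    using A wz by (auto simp: poly_prod)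
  with crit poly_pderiv_prod_linear[of A w z] A wz have "(\<Sum>k\<in>A. 1 / (w - z k)) = 0"
    by simp
  then have "0 = Re (w * (\<Sum>k\<in>A. 1 / (w - z k)))"
    by simp
  also have "\<dots> = (\<Sum>k\<in>A. Re (w / (w - z k)))"
    by (simp add: sum_distrib_left)
  also have "\<dots> > 0"
  proof (intro sum_pos A)
    fix k
    assume k: "k \<in> A"
    have "inner w (z k) \<le> cmod w * cmod (z k)"
      by (rule norm_cauchy_schwarz)
    also have "\<dots> \<le> cmod w * 1"
      using z[OF k] by (intro mult_left_mono) auto
    also have "\<dots> < cmod w * cmod w"
      using w by (intro mult_strict_left_mono) auto
    also have "\<dots> = inner w w"
      by (simp add: dot_square_norm power2_eq_square)
    finally have "inner w (w - z k) > 0"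
      by (simp add: inner_diff_right)
    moreover have "Re (w / (w - z k)) = inner w (w - z k) / (cmod (w - z k))\<^sup>2"
      unfolding Re_divide cmod_power2 inner_complex_def by simp
    ultimately show "Re (w / (w - z k)) > 0"
      using wz[OF k] by simp
  qed
  finally show False
    by simp
qed

text \<open>The point \<open>\<zeta> = (z - c) / (1 - c z)\<close> has modulus below \<open>r\<close>; expanding the left-hand side in \<open>\<zeta>\<close>
  gives the linear coefficient \<open>M\<close>, and \<open>M\<^sup>2 = (1 - c\<^sup>2)\<^sup>2 - c (a - c) (1 - a c)\<close>. The set defined by the
  conclusion is the lens bounded by the two unit circles through \<open>0\<close> and \<open>a\<close>.\<close>

lemma pseudohyperbolic_disc_in_lens:
  fixes a c :: real and z :: complex
  assumes c: "0 < c" "c < a" and a: "a < 1"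
    and near: "cmod (z - of_real c) < c * (a - c) / (2 * (1 - c\<^sup>2)) * cmod (1 - of_real c * z)"
  shows "(cmod z)\<^sup>2 - a * Re z + 2 * sqrt (1 - a\<^sup>2 / 4) * \<bar>Im z\<bar> < 0"
proof -
  define x y where "x = Re z" and "y = Im z"
  define D u r where "D = 1 - c\<^sup>2" and "u = c * (a - c)" and "r = u / (2 * D)"
  define \<eta> where "\<eta> = sqrt (1 - a\<^sup>2 / 4)"
  define \<kappa> where "\<kappa> = c - (1 + c\<^sup>2) * a / 2"
  \<comment> \<open>These are the real and imaginary parts of (z - c) * cnj (1 - c z) = \<zeta> N^2.
    The linear coefficient of the expansion has components \<kappa> and \<eta> D, and Cauchy-Schwarz
    applies to the pairing of the two vectors.\<close>
  define G1 G2 where "G1 = (x - c) * (1 - c * x) - c * y\<^sup>2" and "G2 = D * y"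
  define d N where "d = cmod (z - of_real c)" and "N = cmod (1 - of_real c * z)"
  have a2: "a\<^sup>2 < 1" and c2: "c\<^sup>2 < 1"
    using a c by (simp_all add: power_less_one_iff)
  have D: "D > 0" and u: "u > 0"
    using c c2 by (simp_all add: D_def u_def)
  have ac: "1 - a * c > 0"
    using a c mult_strict_mono[of a 1 c 1] by simp
  have r: "r > 0"
    using D u by (simp add: r_def)
  have \<eta>: "\<eta> \<ge> 0" "\<eta>\<^sup>2 = 1 - a\<^sup>2 / 4"
    using a2 by (simp_all add: \<eta>_def)
  have d2: "d\<^sup>2 = (x - c)\<^sup>2 + y\<^sup>2" and N2: "N\<^sup>2 = (1 - c * x)\<^sup>2 + (c * y)\<^sup>2"
    by (simp_all add: d_def N_def cmod_power2 x_def y_def)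
  have dN: "d < r * N" "d \<ge> 0" "N \<ge> 0"
    using near by (simp_all add: d_def N_def r_def u_def D_def)
  have M2: "\<kappa>\<^sup>2 + (\<eta> * D)\<^sup>2 = D\<^sup>2 - u * (1 - a * c)"
    unfolding power_mult_distrib \<eta>(2) unfolding \<kappa>_def D_def u_def
    by (simp add: field_simps power2_eq_square)
  define M where "M = sqrt (\<kappa>\<^sup>2 + (\<eta> * D)\<^sup>2)"
  \<comment> \<open>Tangent bound sqrt (D^2 - t) <= D - t / (2 D) with t = u (1 - a c).\<close>
  have M: "M \<le> D - u * (1 - a * c) / (2 * D)"
  proof -
    have "0 \<le> D\<^sup>2 - u * (1 - a * c)"
      unfolding M2[symmetric] by simp
    then have "u * (1 - a * c) \<le> D * (2 * D)"
      using mult_pos_pos[OF D D] unfolding power2_eq_square by linarith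
    then have "u * (1 - a * c) / (2 * D) \<le> D"
      using D by (simp add: divide_le_eq)
    moreover have "(D - u * (1 - a * c) / (2 * D))\<^sup>2 = D\<^sup>2 - u * (1 - a * c) + (u * (1 - a * c) / (2 * D))\<^sup>2"
      using D by (simp add: power2_diff)
    ultimately show ?thesis
      unfolding M_def M2 by (intro real_le_lsqrt) auto
  qed
  have "G1 * \<kappa> + \<bar>G2\<bar> * (\<eta> * D) \<le> sqrt (G1\<^sup>2 + \<bar>G2\<bar>\<^sup>2) * M"
  proof (rule power2_le_imp_le)
    have "(G1 * \<kappa> + \<bar>G2\<bar> * (\<eta> * D))\<^sup>2 + (G1 * (\<eta> * D) - \<bar>G2\<bar> * \<kappa>)\<^sup>2
        = (G1\<^sup>2 + \<bar>G2\<bar>\<^sup>2) * (\<kappa>\<^sup>2 + (\<eta> * D)\<^sup>2)"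
      by algebra
    then have "(G1 * \<kappa> + \<bar>G2\<bar> * (\<eta> * D))\<^sup>2 \<le> (G1\<^sup>2 + \<bar>G2\<bar>\<^sup>2) * (\<kappa>\<^sup>2 + (\<eta> * D)\<^sup>2)"
      using zero_le_power2[of "G1 * (\<eta> * D) - \<bar>G2\<bar> * \<kappa>"] by linarith
    then show "(G1 * \<kappa> + \<bar>G2\<bar> * (\<eta> * D))\<^sup>2 \<le> (sqrt (G1\<^sup>2 + \<bar>G2\<bar>\<^sup>2) * M)\<^sup>2"
      by (simp add: power_mult_distrib M_def)
  qed (simp add: M_def)
  also have "G1\<^sup>2 + \<bar>G2\<bar>\<^sup>2 = (d * N)\<^sup>2"
    unfolding power_mult_distrib d2 N2 power2_abs G1_def G2_def D_def by algebra
  also have "sqrt ((d * N)\<^sup>2) = d * N"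
    using dN by simp
  finally have cs: "G1 * \<kappa> + \<bar>G2\<bar> * (\<eta> * D) \<le> d * N * M" .
  have "D\<^sup>2 * ((cmod z)\<^sup>2 - a * x + 2 * \<eta> * \<bar>y\<bar>)
      = - u * N\<^sup>2 + (1 - a * c) * d\<^sup>2 + 2 * (G1 * \<kappa> + \<bar>G2\<bar> * (\<eta> * D))"
  proof -
    have "\<bar>G2\<bar> = D * \<bar>y\<bar>"
      using D by (simp add: G2_def abs_mult)
    moreover have "D\<^sup>2 * (x\<^sup>2 + y\<^sup>2 - a * x) = - u * N\<^sup>2 + (1 - a * c) * d\<^sup>2 + 2 * (G1 * \<kappa>)"
      unfolding d2 N2 G1_def D_def u_def \<kappa>_def by (simp add: field_simps) algebra
    moreover have z2: "(cmod z)\<^sup>2 = x\<^sup>2 + y\<^sup>2"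
      by (simp add: cmod_power2 x_def y_def)
    ultimately show ?thesis
      unfolding z2 by (simp add: algebra_simps power2_eq_square)
  qed
  also have "\<dots> \<le> - u * N\<^sup>2 + (1 - a * c) * d\<^sup>2 + 2 * (d * N * M)"
    using cs by simp
  also have "\<dots> < - u * N\<^sup>2 + (1 - a * c) * (r * N)\<^sup>2 + 2 * (r * N * N * M)"
  proof -
    have "d\<^sup>2 < (r * N)\<^sup>2"
      using dN by (intro power_strict_mono) auto
    then have "(1 - a * c) * d\<^sup>2 < (1 - a * c) * (r * N)\<^sup>2"
      using ac by simp
    moreover have "d * (N * M) \<le> r * N * (N * M)"
      using dN by (intro mult_right_mono) (auto simp: M_def)
    ultimately show ?thesis
      by (simp add: mult.assoc)
  qed
  also have "\<dots> = N\<^sup>2 * (- u + (1 - a * c) * r\<^sup>2 + 2 * r * M)"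
    by (simp add: algebra_simps power2_eq_square)
  \<comment> \<open>The radius satisfies 2 r D = u. The correction term in the bound for
    \<open>M\<close> is worth twice the quadratic term (1 - a c) r^2, which leaves the right
    sign.\<close>
  also have "\<dots> \<le> 0"
  proof -
    have "(1 - a * c) * r\<^sup>2 + 2 * r * M \<le> (1 - a * c) * r\<^sup>2 + 2 * r * (D - u * (1 - a * c) / (2 * D))"
      using M r by simp
    also have "\<dots> = u - u * u * (1 - a * c) / (4 * D\<^sup>2)"
      using D unfolding r_def by (simp add: field_simps power2_eq_square)
    also have "\<dots> \<le> u"
      using u ac D by simp
    finally show ?thesis
      by (simp add: mult_nonneg_nonpos)
  qed
  finally show ?thesis
    using D by (simp add: zero_less_mult_iff mult_less_0_iff x_def y_def \<eta>_def)
qed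

text \<open>The difference |a - w|^2 - |z - w|^2 is affine in w. For z in the lens its minimum over
  the disc cut at Re w = a/2 is attained at a corner a/2 +- i \<eta>. Both corners have distance 1
  from a, and the lens is the set of points at distance below 1 from both of them.\<close>

lemma lens_closer_to_lune:
  fixes a :: real and z w :: complex
  assumes a: "0 < a" "a < 1"
    and lens: "(cmod z)\<^sup>2 - a * Re z + 2 * sqrt (1 - a\<^sup>2 / 4) * \<bar>Im z\<bar> < 0"
    and w: "cmod w \<le> 1" "Re w \<le> a / 2"
  shows "cmod (z - w) < cmod (of_real a - w)" and "z \<noteq> of_real a"
proof -
  define x y where "x = Re z" and "y = \<bar>Im z\<bar>"
  define s t where "s = Re w" and "t = \<bar>Im w\<bar>"
  define \<eta> where "\<eta> = sqrt (1 - a\<^sup>2 / 4)"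
  have a2: "a\<^sup>2 < 1"
    using a by (simp add: power_less_one_iff)
  have \<eta>: "\<eta> > 0" "\<eta>\<^sup>2 = 1 - a\<^sup>2 / 4"
    using a2 by (simp_all add: \<eta>_def)
  have lens': "x\<^sup>2 + y\<^sup>2 - a * x + 2 * \<eta> * y < 0"
    using lens by (simp add: cmod_power2 x_def y_def \<eta>_def)
  have y: "y \<ge> 0"
    by (simp add: y_def)
  have st: "s\<^sup>2 + t\<^sup>2 \<le> 1"
    using power_mono[OF w(1), of 2] by (simp add: cmod_power2 s_def t_def)
  have "x * (a - x) > 2 * \<eta> * y + y\<^sup>2"
    using lens' by (simp add: algebra_simps power2_eq_square)
  moreover have "2 * \<eta> * y \<ge> 0" "y\<^sup>2 \<ge> 0"
    using \<eta> y by simp_all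
  ultimately have pos: "x * (a - x) > 0" and big: "x * (a - x) > 2 * \<eta> * y"
    by linarith+
  from pos a have xa: "0 < x" "x < a"
    by (auto simp: zero_less_mult_iff)
  \<comment> \<open>Once the supporting line of the unit circle at the corner has been used with
    weight \<open>y\<close>, the remaining coefficient of \<open>s\<close> is nonnegative, so
    \<open>s\<close> may be replaced by a/2.\<close>
  have A: "2 * \<eta> * (a - x) \<ge> a * y"
  proof -
    have "a\<^sup>2 * y \<le> 4 * \<eta>\<^sup>2 * y"
      using a2 y unfolding \<eta>(2) by (intro mult_right_mono) auto
    also have "\<dots> = 2 * \<eta> * (2 * \<eta> * y)"
      by (simp add: power2_eq_square)
    also have "\<dots> \<le> 2 * \<eta> * (a * (a - x))"
    proof (intro mult_left_mono)
      have "x * (a - x) \<le> a * (a - x)"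
        using xa by (intro mult_right_mono) auto
      with big show "2 * \<eta> * y \<le> a * (a - x)"
        by simp
    qed (use \<eta> in simp)
    finally have "a * (a * y) \<le> a * (2 * \<eta> * (a - x))"
      by (simp add: algebra_simps power2_eq_square)
    with a show ?thesis
      by simp
  qed
  have tangent: "a / 2 * s + \<eta> * t \<le> 1"
  proof (rule power2_le_imp_le)
    have "(a / 2 * s + \<eta> * t)\<^sup>2 + (a / 2 * t - \<eta> * s)\<^sup>2 = (a\<^sup>2 / 4 + \<eta>\<^sup>2) * (s\<^sup>2 + t\<^sup>2)"
      by (simp add: field_simps) algebra
    also have "\<dots> \<le> 1"
      using st \<eta> by simp
    finally show "(a / 2 * s + \<eta> * t)\<^sup>2 \<le> 1\<^sup>2"
      using zero_le_power2[of "a / 2 * t - \<eta> * s"] unfolding one_power2 by linarith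
  qed simp
  have "\<eta> * (s * (a - x) + t * y) = y * (a / 2 * s + \<eta> * t) + s * (\<eta> * (a - x) - a * y / 2)"
    by (simp add: algebra_simps)
  also have "\<dots> \<le> y * 1 + a / 2 * (\<eta> * (a - x) - a * y / 2)"
    using tangent y A w(2) by (intro add_mono mult_left_mono mult_right_mono) (auto simp: s_def)
  also have "\<dots> = \<eta> * (a / 2 * (a - x)) + y * \<eta>\<^sup>2"
    unfolding \<eta>(2) by (simp add: field_simps power2_eq_square)
  also have "\<dots> = \<eta> * (a / 2 * (a - x) + \<eta> * y)"
    by (simp add: algebra_simps power2_eq_square)
  finally have "s * (a - x) + t * y \<le> a / 2 * (a - x) + \<eta> * y"
    using \<eta> by simp
  then have le: "2 * (s * (a - x)) + 2 * (t * y) \<le> a\<^sup>2 - a * x + 2 * \<eta> * y"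
    by (simp add: field_simps power2_eq_square)
  have "Im w * (- Im z) \<le> t * y"
    using abs_ge_self[of "Im w * (- Im z)"] by (simp add: t_def y_def abs_mult)
  moreover have "(cmod (of_real a - w))\<^sup>2 - (cmod (z - w))\<^sup>2
      = a\<^sup>2 - x\<^sup>2 - y\<^sup>2 - 2 * (s * (a - x) + Im w * (- Im z))"
    unfolding cmod_power2 x_def y_def s_def power2_abs
    by (simp add: power2_eq_square algebra_simps)
  ultimately have "(cmod (of_real a - w))\<^sup>2 - (cmod (z - w))\<^sup>2 > 0"
    using le lens' unfolding distrib_left[of 2] by linarith
  then show "cmod (z - w) < cmod (of_real a - w)"
    using power2_less_imp_less[of "cmod (z - w)" "cmod (of_real a - w)"] by simp
  show "z \<noteq> of_real a"
    using xa by (auto simp: x_def)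
qed

subsection \<open>Counterexamples to the conjecture\<close>

lemma prod_le_exp_sum:
  fixes f g :: "'b \<Rightarrow> real"
  assumes "\<And>i. i \<in> A \<Longrightarrow> 0 \<le> f i" "\<And>i. i \<in> A \<Longrightarrow> f i \<le> exp (g i)"
  shows "prod f A \<le> exp (sum g A)"
  using assms
proof (induction A rule: infinite_finite_induct)
  case (insert i A)
  then show ?case
    by (simp add: exp_add mult_mono prod_nonneg)
qed simp_all

lemma le_exp_half:
  fixes y t :: real
  assumes "y\<^sup>2 \<le> 1 + t"
  shows "y \<le> exp (t / 2)"
proof (rule power2_le_imp_le)
  have "y\<^sup>2 \<le> exp t"
    using assms exp_ge_add_one_self[of t] by linarith
  also have "exp t = (exp (t / 2))\<^sup>2"
    by (simp flip: exp_double)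
  finally show "y\<^sup>2 \<le> (exp (t / 2))\<^sup>2" .
qed simp

text \<open>Zeros and critical points are lists with multiplicity, with \<open>a\<close> at index 0,
  so that sums and products over them can be estimated termwise.\<close>

locale sendov_counterexample =
  fixes a :: real and n :: nat and z w :: "nat \<Rightarrow> complex" and P :: "complex poly"
  assumes a: "0 < a" "a < 1" and n: "n \<ge> 2"
    and P: "P = (\<Prod>k<n. [:- z k, 1:])"
    and z0: "z 0 = of_real a" and z_le: "k < n \<Longrightarrow> cmod (z k) \<le> 1"
    and P': "pderiv P = smult (of_nat n) (\<Prod>j<n - 1. [:- w j, 1:])"
    and w_far: "j < n - 1 \<Longrightarrow> cmod (w j - of_real a) > 1"
begin

lemma w_le: "cmod (w j) \<le> 1" if "j < n - 1"
proof (rule gauss_lucas_unit_disc)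
  show "poly (pderiv (\<Prod>k<n. [:- z k, 1:])) (w j) = 0"
    unfolding P[symmetric] P' using that by (auto simp: poly_prod)
  show "{..<n} \<noteq> {}"
    using n by (simp add: lessThan_empty_iff)
qed (use z_le in auto)

lemma Re_w_le: "Re (w j) \<le> a / 2" if "j < n - 1"
proof -
  have "1 < (cmod (w j - of_real a))\<^sup>2"
    using w_far[OF that] by (simp add: one_less_power)
  also have "\<dots> = (cmod (w j))\<^sup>2 - 2 * a * Re (w j) + a\<^sup>2"
    by (simp add: cmod_power2) (simp add: power2_eq_square algebra_simps)
  also have "\<dots> \<le> 1 - 2 * a * Re (w j) + a\<^sup>2"
    using w_le[OF that] by (simp add: power_le_one)
  finally have "a * (2 * Re (w j)) < a * a"
    by (simp add: power2_eq_square)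
  with a show ?thesis
    by simp
qed

lemma dist_a_le_2: "cmod (of_real a - w j) \<le> 2" if "j < n - 1"
  using norm_triangle_ineq4[of "of_real a" "w j"] w_le[OF that] a by simp

text \<open>Zeros and critical points have the same mean: compare the subleading coefficients of P
  and P'.\<close>

lemma centroid: "real n * (\<Sum>j<n - 1. Re (w j)) = real (n - 1) * (\<Sum>k<n. Re (z k))"
proof -
  have "coeff (pderiv P) (n - 2) = of_nat (n - 1) * coeff P (n - 1)"
    using n by (simp add: coeff_pderiv Suc_diff_Suc numeral_2_eq_2)
  moreover have "coeff (pderiv P) (n - 2) = of_nat n * - (\<Sum>j<n - 1. w j)"
    using coeff_prod_linear_subleading[of "n - 1" w] n unfolding P' by (simp add: numeral_2_eq_2)
  moreover have "coeff P (n - 1) = - (\<Sum>k<n. z k)"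
    using coeff_prod_linear_subleading[of n z] n unfolding P by simp
  ultimately have "of_nat n * (\<Sum>j<n - 1. w j) = of_nat (n - 1) * (\<Sum>k<n. z k)"
    by simp
  from arg_cong[OF this, of Re] show ?thesis
    by simp
qed

text \<open>This is |P'(a)| / n, the scale against which P and P' are measured.\<close>

definition critical_prod :: real where
  "critical_prod = (\<Prod>j<n - 1. cmod (of_real a - w j))"

lemma critical_prod_ge_1: "critical_prod \<ge> 1"
  unfolding critical_prod_def using w_far by (intro prod_ge_1) (auto simp: norm_minus_commute less_imp_le)

lemma poly_P_a: "poly P (of_real a) = 0"
  using n unfolding P z0[symmetric] by (auto simp: poly_prod intro!: bexI[of _ 0])

lemma poly_lower_bound:
  assumes "0 \<le> \<rho>" "\<rho> < 1"
    and "\<And>j. j < n - 1 \<Longrightarrow> cmod (b - w j) \<le> \<rho> * cmod (of_real a - w j)"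
  shows "(1 - \<rho> ^ n) / (1 + \<rho>) * cmod (b - of_real a) * critical_prod \<le> cmod (poly P b)"
  unfolding critical_prod_def
  using n assms by (intro poly_lower_bound_from_critical_points P' poly_P_a) auto

text \<open>A point of the lens is strictly closer than \<open>a\<close> to each of the finitely
  many critical points. The largest ratio of distances is therefore below 1, and the lower bound for
  |P(b)| is positive.\<close>

lemma zero_not_in_lens:
  assumes "(cmod b)\<^sup>2 - a * Re b + 2 * sqrt (1 - a\<^sup>2 / 4) * \<bar>Im b\<bar> < 0"
  shows "poly P b \<noteq> 0"
proof -
  define ratio where "ratio j = cmod (b - w j) / cmod (of_real a - w j)" for j
  define \<rho> where "\<rho> = Max (insert 0 (ratio ` {..<n - 1}))"
  have pos: "cmod (of_real a - w j) > 0" if "j < n - 1" for j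
    using w_far[OF that] by (metis norm_minus_commute less_trans zero_less_one)
  have closer: "cmod (b - w j) < cmod (of_real a - w j)" if "j < n - 1" for j
    using lens_closer_to_lune(1)[OF a assms] w_le Re_w_le that by blast
  have b: "b \<noteq> of_real a"
    using lens_closer_to_lune(2)[OF a assms, of 0] a by simp
  have \<rho>1: "\<rho> < 1"
    unfolding \<rho>_def using closer by (subst Max_less_iff) (auto simp: ratio_def divide_less_eq)
  have \<rho>0: "\<rho> \<ge> 0"
    unfolding \<rho>_def by (intro Max_ge) auto
  have "ratio j \<le> \<rho>" if "j < n - 1" for j
    unfolding \<rho>_def using that by (intro Max_ge) auto
  then have "(1 - \<rho> ^ n) / (1 + \<rho>) * cmod (b - of_real a) * critical_prod \<le> cmod (poly P b)"
    using \<rho>0 \<rho>1 pos by (intro poly_lower_bound) (auto simp: ratio_def divide_le_eq)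
  moreover have "(1 - \<rho> ^ n) / (1 + \<rho>) * cmod (b - of_real a) * critical_prod > 0"
    using \<rho>0 \<rho>1 b n critical_prod_ge_1 by (intro mult_pos_pos divide_pos_pos) (auto simp: power_less_one_iff)
  ultimately show ?thesis
    by auto
qed

section \<open>Estimates at a/4 and the size of P at the origin\<close>

lemma dist_real_sq:
  "(cmod (of_real b - w j))\<^sup>2 = (cmod (of_real a - w j))\<^sup>2 - 2 * (a - b) * (a - Re (w j)) + (a - b)\<^sup>2"
  by (simp add: cmod_power2) (simp add: power2_eq_square algebra_simps)

text \<open>The ratio is the one at the corners of the lune, where |a - w| = 1 and Re w = a/2.
  Elsewhere the slack contains the factor (a - 2 x) (1 - a^2/4), which is nonnegative.\<close>

lemma dist_quarter_le:
  assumes j: "j < n - 1"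
  shows "cmod (of_real (a / 4) - w j) \<le> sqrt (1 - 3 * a\<^sup>2 / 16) * cmod (of_real a - w j)"
proof -
  define x where "x = Re (w j)"
  define q where "q = (cmod (of_real a - w j))\<^sup>2"
  have x: "x \<le> a / 2"
    using Re_w_le[OF j] by (simp add: x_def)
  have a2: "a\<^sup>2 < 1"
    using a by (simp add: power_less_one_iff)
  have "q = (cmod (w j))\<^sup>2 - 2 * a * x + a\<^sup>2"
    by (simp add: q_def x_def cmod_power2) (simp add: power2_eq_square algebra_simps)
  also have "\<dots> \<le> 1 - 2 * a * x + a\<^sup>2"
    using w_le[OF j] by (simp add: power_le_one)
  finally have q: "q \<le> 1 - 2 * a * x + a\<^sup>2" .
  have "(cmod (of_real (a / 4) - w j))\<^sup>2 = q - 2 * (3 * a / 4) * (a - x) + (3 * a / 4)\<^sup>2"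
    unfolding dist_real_sq[of "a / 4"] by (simp add: q_def x_def)
  also have "\<dots> \<le> (1 - 3 * a\<^sup>2 / 16) * q"
  proof -
    have "3 * a\<^sup>2 / 16 * q \<le> 3 * a\<^sup>2 / 16 * (1 - 2 * a * x + a\<^sup>2)"
      using q by (intro mult_left_mono) auto
    moreover have "2 * (3 * a / 4) * (a - x) - (3 * a / 4)\<^sup>2 - 3 * a\<^sup>2 / 16 * (1 - 2 * a * x + a\<^sup>2)
        = 3 * a / 4 * ((a - 2 * x) * (1 - a\<^sup>2 / 4))"
      by (simp add: field_simps power2_eq_square)
    moreover have "3 * a / 4 * ((a - 2 * x) * (1 - a\<^sup>2 / 4)) \<ge> 0"
      using a a2 x by (intro mult_nonneg_nonneg) auto
    ultimately show ?thesis
      by (simp only: left_diff_distrib mult_1)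
  qed
  finally have "(cmod (of_real (a / 4) - w j))\<^sup>2 \<le> (sqrt (1 - 3 * a\<^sup>2 / 16) * cmod (of_real a - w j))\<^sup>2"
    using a2 by (simp add: power_mult_distrib q_def)
  then show ?thesis
    by (rule power2_le_imp_le) (use a2 in simp)
qed

lemma poly_quarter_lower_bound:
  assumes E: "exp (- (real n * a\<^sup>2 / 32)) \<le> a\<^sup>2 / 40"
  shows "cmod (poly P (of_real (a / 4))) \<ge> 117 / 320 * a * critical_prod"
proof -
  define \<rho> where "\<rho> = sqrt (1 - 3 * a\<^sup>2 / 16)"
  have a2: "0 < a\<^sup>2" "a\<^sup>2 < 1"
    using a by (simp_all add: power_less_one_iff)
  have \<rho>: "0 \<le> \<rho>" "\<rho> < 1"
    using a2 by (auto simp: \<rho>_def)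
  have "\<rho>\<^sup>2 = 1 + (- (3 * a\<^sup>2 / 16))"
    using a2 by (simp add: \<rho>_def)
  then have "\<rho> \<le> exp (- (3 * a\<^sup>2 / 16) / 2)"
    by (intro le_exp_half) simp
  then have "\<rho> ^ n \<le> exp (- (3 * a\<^sup>2 / 16) / 2) ^ n"
    using \<rho> by (intro power_mono) auto
  also have "\<dots> = exp (- (3 * (real n * a\<^sup>2 / 32)))"
    by (simp flip: exp_of_nat_mult)
  also have "\<dots> \<le> exp (- (real n * a\<^sup>2 / 32))"
    by simp
  also have "\<dots> \<le> 1 / 40"
    using E a2 by simp
  finally have "39 / 40 \<le> 1 - \<rho> ^ n"
    by simp
  \<comment> \<open>With |a/4 - a| = 3a/4 this yields the constant 117/320 = (39/80) (3/4).\<close>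
  then have "39 / 40 / 2 \<le> (1 - \<rho> ^ n) / (1 + \<rho>)"
    using \<rho> by (intro frac_le) auto
  then have "39 / 40 / 2 * (3 * a / 4) * critical_prod
      \<le> (1 - \<rho> ^ n) / (1 + \<rho>) * (3 * a / 4) * critical_prod"
    using a critical_prod_ge_1 by (intro mult_right_mono) auto
  also have "3 * a / 4 = cmod (of_real (a / 4) - of_real a)"
    using a unfolding of_real_diff[symmetric] norm_of_real by simp
  also have "(1 - \<rho> ^ n) / (1 + \<rho>) * \<dots> * critical_prod \<le> cmod (poly P (of_real (a / 4)))"
    using \<rho> dist_quarter_le by (intro poly_lower_bound) (auto simp: \<rho>_def)
  finally show ?thesis
    using a by simp
qed

lemma sum_Re_w_le:
  assumes E: "exp (- (real n * a\<^sup>2 / 32)) \<le> a\<^sup>2 / 40"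
  shows "(\<Sum>j<n - 1. Re (w j)) \<le> real (n - 1) * (a / 4)"
proof -
  have "(\<Sum>k<n. Re (z k)) \<le> real n * (a / 4)"
  proof (rule ccontr)
    assume neg: "\<not> ?thesis"
    have "cmod (of_real (a / 4) - z k) \<le> exp ((a\<^sup>2 / 16 - a / 2 * Re (z k)) / 2)" if "k < n" for k
    proof (rule le_exp_half)
      have "(cmod (of_real (a / 4) - z k))\<^sup>2 = (cmod (z k))\<^sup>2 + (a\<^sup>2 / 16 - a / 2 * Re (z k))"
        by (simp add: cmod_power2) (simp add: power2_eq_square field_simps)
      then show "(cmod (of_real (a / 4) - z k))\<^sup>2 \<le> 1 + (a\<^sup>2 / 16 - a / 2 * Re (z k))"
        using z_le[OF that] by (simp add: power_le_one)
    qed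
    then have "(\<Prod>k<n. cmod (of_real (a / 4) - z k)) \<le> exp (\<Sum>k<n. (a\<^sup>2 / 16 - a / 2 * Re (z k)) / 2)"
      by (intro prod_le_exp_sum) auto
    also have "(\<Sum>k<n. (a\<^sup>2 / 16 - a / 2 * Re (z k)) / 2) = real n * (a\<^sup>2 / 32) - a / 4 * (\<Sum>k<n. Re (z k))"
      by (simp add: sum_subtractf diff_divide_distrib sum_distrib_left flip: sum_divide_distrib)
    also have "\<dots> \<le> real n * (a\<^sup>2 / 32) - a / 4 * (real n * (a / 4))"
      using neg a by (intro diff_left_mono mult_left_mono) auto
    \<comment> \<open>At mean a/4 the exponent is n (a^2/32 - a^2/16), exactly the one controlled by
      \<open>E\<close>.\<close>
    also have "\<dots> = - (real n * a\<^sup>2 / 32)"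
      by (simp add: field_simps power2_eq_square)
    finally have "(\<Prod>k<n. cmod (of_real (a / 4) - z k)) \<le> exp (- (real n * a\<^sup>2 / 32))"
      by simp
    also have "(\<Prod>k<n. cmod (of_real (a / 4) - z k)) = cmod (poly P (of_real (a / 4)))"
      by (simp add: P poly_prod prod_norm)
    finally have "117 / 320 * a * critical_prod \<le> a\<^sup>2 / 40"
      using poly_quarter_lower_bound[OF E] E by linarith
    moreover have "117 / 320 * a * 1 \<le> 117 / 320 * a * critical_prod"
      using a critical_prod_ge_1 by (intro mult_left_mono) auto
    moreover have "a\<^sup>2 \<le> a"
      using a by (simp add: power2_eq_square mult_left_le_one_le)
    ultimately show False
      using a by simp
  qed
  then have "real (n - 1) * (\<Sum>k<n. Re (z k)) \<le> real (n - 1) * (real n * (a / 4))"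
    by (intro mult_left_mono) auto
  then have "real n * (\<Sum>j<n - 1. Re (w j)) \<le> real n * (real (n - 1) * (a / 4))"
    unfolding centroid by (simp add: mult_ac)
  then show ?thesis
    using n by (subst (asm) mult_le_cancel_left_pos) auto
qed

text \<open>Moving from a to t shrinks the factor at w_j by a relative amount proportional to (a -
  t) (a/2 - Re w_j), and the mean of a/2 - Re w_j is at least a/4.\<close>

lemma pderiv_upper_bound:
  assumes E: "exp (- (real n * a\<^sup>2 / 32)) \<le> a\<^sup>2 / 40"
    and t: "0 \<le> t" "t \<le> a"
  shows "cmod (poly (pderiv P) (of_real t)) \<le> real n * critical_prod * exp (- ((a - t) * real (n - 1) * a / 16))"
proof -
  define g where "g j = - ((a - t) / 2 * (a / 2 - Re (w j)))" for j
  have fac: "cmod (of_real t - w j) / cmod (of_real a - w j) \<le> exp (g j / 2)" if j: "j < n - 1" for j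
  proof (rule le_exp_half)
    define q where "q = (cmod (of_real a - w j))\<^sup>2"
    have q1: "q > 0" 
      using w_far[OF j] by (auto simp: q_def norm_minus_commute)
    have q4: "q \<le> 4"
      using power_mono[OF dist_a_le_2[OF j], of 2] by (simp add: q_def)
    have h: "(a - t) * (a / 2 - Re (w j)) \<ge> 0"
      using Re_w_le[OF j] t by simp
    have "(cmod (of_real t - w j))\<^sup>2 = q - 2 * ((a - t) * (a / 2 - Re (w j))) - (a - t) * t"
      unfolding dist_real_sq[of t] q_def[symmetric] by (simp add: field_simps power2_eq_square)
    also have "\<dots> \<le> q - 2 * ((a - t) * (a / 2 - Re (w j)))"
      using t by simp
    \<comment> \<open>The bound |a - w_j|^2 <= 4 turns the absolute decrease into a relative
      one.\<close>
    also have "\<dots> \<le> q - q / 2 * ((a - t) * (a / 2 - Re (w j)))"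
      using mult_right_mono[OF q4 h] by simp
    also have "\<dots> = q * (1 + g j)"
      by (simp add: g_def field_simps)
    finally show "(cmod (of_real t - w j) / cmod (of_real a - w j))\<^sup>2 \<le> 1 + g j"
      using q1 by (simp add: power_divide divide_le_eq mult.commute flip: q_def)
  qed
  have "cmod (poly (pderiv P) (of_real t)) = real n * (\<Prod>j<n - 1. cmod (of_real t - w j))"
    by (simp add: P' poly_prod norm_mult prod_norm)
  also have "(\<Prod>j<n - 1. cmod (of_real t - w j))
      = critical_prod * (\<Prod>j<n - 1. cmod (of_real t - w j) / cmod (of_real a - w j))"
  proof -
    have "cmod (of_real t - w j) = cmod (of_real a - w j) * (cmod (of_real t - w j) / cmod (of_real a - w j))"
      if "j < n - 1" for j
      using w_far[OF that] by auto
    then show ?thesis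
      unfolding critical_prod_def prod.distrib[symmetric] by (intro prod.cong) auto
  qed
  also have "(\<Prod>j<n - 1. cmod (of_real t - w j) / cmod (of_real a - w j)) \<le> exp (\<Sum>j<n - 1. g j / 2)"
    using fac by (intro prod_le_exp_sum) auto
  also have "(\<Sum>j<n - 1. g j / 2) \<le> - ((a - t) * real (n - 1) * a / 16)"
  proof -
    have "(\<Sum>j<n - 1. g j / 2) = - ((a - t) / 4 * (real (n - 1) * (a / 2) - (\<Sum>j<n - 1. Re (w j))))"
      by (simp add: g_def sum_subtractf sum_negf flip: sum_distrib_left sum_divide_distrib)
    also have "\<dots> \<le> - ((a - t) / 4 * (real (n - 1) * (a / 2) - real (n - 1) * (a / 4)))"
      using sum_Re_w_le[OF E] t by (intro le_imp_neg_le mult_left_mono diff_left_mono) auto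
    finally show ?thesis
      by (simp add: algebra_simps)
  qed
  finally show ?thesis
    using n critical_prod_ge_1 by (simp add: mult.assoc mult_left_mono)
qed

text \<open>The product is |P(0)| / a. The mean value inequality on [0, a/4] shows that P(0) cannot
  fall far below P(a/4) in modulus, since P' is small there.\<close>

lemma prod_zeros_ge:
  assumes E: "exp (- (real n * a\<^sup>2 / 32)) \<le> a\<^sup>2 / 40"
  shows "(\<Prod>k\<in>{1..<n}. cmod (z k)) \<ge> a / 16"
proof -
  have a2: "0 < a\<^sup>2" "a\<^sup>2 < 1"
    using a by (simp_all add: power_less_one_iff)
  define B where "B = real n * exp (- (3 * real (n - 1) * a\<^sup>2 / 64))"
  have B: "B \<le> 21 / 25"
  proof -
    define y where "y = real n * a\<^sup>2 / 64"
    have "2 * y \<le> exp y"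
    proof -
      have "0 \<le> y"
        by (simp add: y_def)
      then have "1 + y + y\<^sup>2 / 2 \<le> exp y"
        by (rule exp_lower_Taylor_quadratic)
      moreover have "(y - 1)\<^sup>2 \<ge> 0"
        by simp
      ultimately show ?thesis
        by (simp add: power2_diff)
    qed
    then have 1: "real n * exp (- y) \<le> 32 / a\<^sup>2"
      using a2 by (simp add: y_def exp_minus field_simps)
    have 2: "exp (3 * a\<^sup>2 / 64) \<le> 64 / 61"
    proof -
      have "61 / 64 \<le> 1 + (- (3 * a\<^sup>2 / 64))"
        using a2 by simp
      also have "\<dots> \<le> exp (- (3 * a\<^sup>2 / 64))"
        by (rule exp_ge_add_one_self)
      finally show ?thesis
        by (simp add: exp_minus field_simps)
    qed
    \<comment> \<open>The exponent is split in three: the first part absorbs the factor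
      \<open>n\<close>, the second is bounded by \<open>E\<close>, the third makes up for n - 1 in
      place of n.\<close>
    have "B = (real n * exp (- y)) * exp (- (real n * a\<^sup>2 / 32)) * exp (3 * a\<^sup>2 / 64)"
      using n by (simp add: B_def y_def of_nat_diff field_simps flip: exp_add)
    also have "\<dots> \<le> (32 / a\<^sup>2) * (a\<^sup>2 / 40) * (64 / 61)"
      using 1 2 E by (intro mult_mono) auto
    also have "\<dots> \<le> 21 / 25"
      using a by simp
    finally show ?thesis .
  qed
  have "cmod (poly P (of_real (a / 4)) - poly P 0) \<le> (critical_prod * B) * cmod (of_real (a / 4) - 0)"
  proof (rule field_differentiable_bound[where S = "closed_segment 0 (of_real (a / 4))"])
    fix x
    assume "x \<in> closed_segment 0 (complex_of_real (a / 4))"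
    then obtain s where s: "0 \<le> s" "s \<le> 1" "x = of_real (s * (a / 4))"
      by (auto simp: closed_segment_def scaleR_conv_of_real)
    then have t: "0 \<le> s * (a / 4)" "s * (a / 4) \<le> a / 4"
      using a by (auto simp: mult_left_le_one_le)
    have "3 * a / 4 * (real (n - 1) * a / 16) \<le> (a - s * (a / 4)) * (real (n - 1) * a / 16)"
      using t a by (intro mult_right_mono) auto
    then have "exp (- ((a - s * (a / 4)) * real (n - 1) * a / 16)) \<le> exp (- (3 * real (n - 1) * a\<^sup>2 / 64))"
      by (simp add: power2_eq_square mult_ac)
    then have "(critical_prod * real n) * exp (- ((a - s * (a / 4)) * real (n - 1) * a / 16))
        \<le> (critical_prod * real n) * exp (- (3 * real (n - 1) * a\<^sup>2 / 64))"
      using critical_prod_ge_1 by (intro mult_left_mono) auto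
    then have "real n * critical_prod * exp (- ((a - s * (a / 4)) * real (n - 1) * a / 16)) \<le> critical_prod * B"
      by (simp only: B_def mult_ac)
    with pderiv_upper_bound[OF E, of "s * (a / 4)"] t a show "norm (poly (pderiv P) x) \<le> critical_prod * B"
      unfolding s(3) by linarith
  qed (auto intro: poly_DERIV has_field_derivative_at_within)
  also have "\<dots> \<le> (critical_prod * (21 / 25)) * (a / 4)"
    using a B critical_prod_ge_1 by (intro mult_mono) (auto simp: B_def)
  finally have "cmod (poly P (of_real (a / 4))) - cmod (poly P 0) \<le> critical_prod * (21 / 25) * (a / 4)"
    using norm_triangle_ineq2[of "poly P (of_real (a / 4))" "poly P 0"] by linarith
  moreover have "a * critical_prod > 0"
    using a critical_prod_ge_1 by simp
  \<comment> \<open>The margin is 117/320 - 21/100 > 1/16.\<close>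
  ultimately have "a * critical_prod / 16 \<le> cmod (poly P 0)"
    using poly_quarter_lower_bound[OF E] by (simp add: algebra_simps)
  moreover have "a * 1 \<le> a * critical_prod"
    using a critical_prod_ge_1 by (intro mult_left_mono) auto
  moreover have "cmod (poly P 0) = a * (\<Prod>k\<in>{1..<n}. cmod (z k))"
  proof -
    have "{..<n} = insert 0 {1..<n}"
      using n by auto
    then have "(\<Prod>k<n. cmod (z k)) = cmod (z 0) * (\<Prod>k\<in>{1..<n}. cmod (z k))"
      by simp
    then show ?thesis
      using a by (simp add: P poly_prod z0 norm_minus_cancel flip: prod_norm)
  qed
  ultimately have "a * (1 / 16) \<le> a * (\<Prod>k\<in>{1..<n}. cmod (z k))"
    by simp
  with a show ?thesis
    by simp
qed

end

subsection \<open>Logarithmic estimates at an interior point\<close>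

lemma ln_ge_affine_on_segment:
  fixes A B k l p q x :: real
  assumes x: "p \<le> x" "x \<le> q" and pos: "0 < A + B * p" "0 < A + B * q"
    and ends: "k + l * p \<le> ln (A + B * p)" "k + l * q \<le> ln (A + B * q)"
  shows "k + l * x \<le> ln (A + B * x)"
proof (cases "p = q")
  case False
  with x have pq: "p < q"
    by simp
  define t where "t = (x - p) / (q - p)"
  have t: "0 \<le> t" "t \<le> 1"
    using x pq by (auto simp: t_def divide_le_eq)
  have xt: "x = (1 - t) * p + t * q"
  proof -
    have "t * (q - p) = x - p"
      using pq by (simp add: t_def)
    then show ?thesis
      by (simp add: algebra_simps)
  qed
  have "k + l * x = (1 - t) * (k + l * p) + t * (k + l * q)"
    by (simp add: xt algebra_simps)
  also have "\<dots> \<le> (1 - t) * ln (A + B * p) + t * ln (A + B * q)"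
    using ends t by (intro add_mono mult_left_mono) auto
  also have "\<dots> \<le> ln ((1 - t) *\<^sub>R (A + B * p) + t *\<^sub>R (A + B * q))"
    using t pos by (intro concave_onD[OF ln_concave]) auto
  also have "(1 - t) *\<^sub>R (A + B * p) + t *\<^sub>R (A + B * q) = A + B * x"
    by (simp add: xt algebra_simps)
  finally show ?thesis .
qed (use assms in auto)

text \<open>For fixed real part, \<open>\<bar>1 - c w\<bar>\<close> is smallest on the inner boundary of the lune
  (the real axis or the circle around \<open>a\<close>), where its logarithm is concave in \<open>Re w\<close>.\<close>

lemma ln_norm_lune_ge:
  fixes a c l :: real and w :: complex
  defines "m \<equiv> ln (1 + c\<^sup>2 - a * c) / 2"
  assumes c: "0 < c" "c < 1" and a: "0 < a" "a < 1"
    and w: "cmod w \<le> 1" "cmod (w - of_real a) \<ge> 1" "Re w \<le> a / 2"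
    and l1: "l * (1 - a / 2) \<le> ln (1 + c - a * c) - m"
    and l2: "l * (1 + a / 2) \<le> ln (1 + c) - m"
  shows "m + l * (a / 2 - Re w) \<le> ln (cmod (1 - of_real c * w))"
proof -
  define x where "x = Re w"
  have ac: "a * c < 1" "a * c > 0" "a * c < c"
    using a c mult_strict_mono[of a 1 c 1] by auto
  have x1: "- 1 \<le> x"
    using abs_Re_le_cmod[of w] w(1) by (simp add: x_def)
  show ?thesis
  proof (cases "x \<le> a - 1")
    \<comment> \<open>Here the inner boundary is the real segment [-1, a - 1]. The hypotheses
      \<open>l2\<close> and \<open>l1\<close> are the required inequalities at its two ends.\<close>
    case True
    have pos: "0 < 1 + - c * x"
      using mult_pos_neg[of c x] c True a by simp
    have "(m + l * (a / 2)) + - l * x \<le> ln (1 + - c * x)"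
      using x1 True c ac l1 l2
      by (intro ln_ge_affine_on_segment[of "- 1" x "a - 1"]) (auto simp: algebra_simps)
    also have "\<dots> \<le> ln (cmod (1 - of_real c * w))"
      using complex_Re_le_cmod[of "1 - of_real c * w"] pos by (intro ln_mono) (auto simp: x_def)
    finally show ?thesis
      by (simp add: x_def algebra_simps)
  next
    case False
    \<comment> \<open>On the circle |w - a| = 1, the value of |1 - c w|^2 is A + B Re w. The segment
      runs from the real point a - 1 to the corner abscissa a/2, where the affine bound is an
      equality.\<close>
    define A B where "A = 1 + c\<^sup>2 * (1 - a\<^sup>2)" and "B = - 2 * c * (1 - a * c)"
    have end1: "A + B * (a - 1) = (1 + c - a * c)\<^sup>2"
      by (simp add: A_def B_def power2_eq_square algebra_simps)
    have end2: "A + B * (a / 2) = 1 + c\<^sup>2 - a * c"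
      by (simp add: A_def B_def power2_eq_square algebra_simps)
    have "c\<^sup>2 > 0"
      using c by simp
    then have S: "1 + c\<^sup>2 - a * c > 0"
      using ac by linarith
    have T: "1 + c - a * c > 0"
      using ac c by linarith
    have Bneg: "B \<le> 0"
      using c ac by (simp add: B_def mult_nonpos_nonneg)
    have pos: "A + B * x > 0"
    proof -
      have "B * (a / 2) \<le> B * x"
        using w(3) Bneg by (intro mult_left_mono_neg) (auto simp: x_def)
      with S end2 show ?thesis
        by linarith
    qed
    have "(2 * m + l * a) + - 2 * l * x \<le> ln (A + B * x)"
    proof (rule ln_ge_affine_on_segment[of "a - 1" x "a / 2"])
      show "(2 * m + l * a) + - 2 * l * (a - 1) \<le> ln (A + B * (a - 1))"
        using l1 T unfolding end1 by (simp add: ln_realpow algebra_simps)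
      show "(2 * m + l * a) + - 2 * l * (a / 2) \<le> ln (A + B * (a / 2))"
        unfolding end2 by (simp add: m_def)
      show "0 < A + B * (a - 1)" "0 < A + B * (a / 2)"
        unfolding end1 end2 using S T by auto
    qed (use False w(3) in \<open>auto simp: x_def\<close>)
    also have "\<dots> \<le> ln ((cmod (1 - of_real c * w))\<^sup>2)"
    proof (subst ln_le_cancel_iff)
      have "1 \<le> (cmod (w - of_real a))\<^sup>2"
        using w(2) by simp
      also have "\<dots> = (cmod w)\<^sup>2 - 2 * a * x + a\<^sup>2"
        by (simp add: cmod_power2 x_def) (simp add: power2_eq_square algebra_simps)
      finally have "c\<^sup>2 * (1 - a\<^sup>2 + 2 * a * x) \<le> c\<^sup>2 * (cmod w)\<^sup>2"
        by (intro mult_left_mono) auto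
      moreover have sq: "(cmod (1 - of_real c * w))\<^sup>2 = 1 - 2 * c * x + c\<^sup>2 * (cmod w)\<^sup>2"
        unfolding cmod_power2 x_def by (simp add: power2_eq_square algebra_simps)
      ultimately show "A + B * x \<le> (cmod (1 - of_real c * w))\<^sup>2"
        by (simp add: A_def B_def sq algebra_simps power2_eq_square)
      with pos show "0 < (cmod (1 - of_real c * w))\<^sup>2"
        by linarith
    qed (rule pos)
    also have "\<dots> = 2 * ln (cmod (1 - of_real c * w))"
    proof -
      have "c * cmod w < 1"
        using c mult_left_mono[OF w(1), of c] by linarith
      then have "1 - of_real c * w \<noteq> 0"
        using c by (metis norm_mult norm_of_real norm_one abs_of_pos eq_iff_diff_eq_0 less_irrefl)
      then show ?thesis
        by (simp add: ln_realpow)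
    qed
    finally show ?thesis
      by (simp add: x_def algebra_simps)
  qed
qed

text \<open>With s = exp (-y), the function y -> ln ((c + s) / (1 + c s)) is convex and vanishes at
  0, so on [0, -ln r] it lies below its chord.\<close>

lemma ln_moebius_chord:
  fixes c r \<rho> :: real
  assumes c: "0 < c" "c < 1" and r: "0 < r" "r < 1" and \<rho>: "r \<le> \<rho>" "\<rho> \<le> 1"
  shows "ln r / ln ((c + r) / (1 + c * r)) * ln ((c + \<rho>) / (1 + c * \<rho>)) \<le> ln \<rho>"
    and "ln ((c + r) / (1 + c * r)) < 0"
proof -
  define f where "f y = ln (c + exp (- y)) - ln (1 + c * exp (- y))" for y :: real
  define f' where "f' y = - exp (- y) / (c + exp (- y)) + c * exp (- y) / (1 + c * exp (- y))" for y :: real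
  have f_ln: "f (- ln s) = ln ((c + s) / (1 + c * s))" if "s > 0" for s
  proof -
    have "c + s > 0" "1 + c * s > 0"
      using that c by (auto intro: add_pos_pos)
    with that show ?thesis
      by (simp add: f_def ln_div)
  qed
  have "convex_on {0..} f"
  proof (rule convex_on_realI)
    fix y :: real
    have "c + exp (- y) > 0" "1 + c * exp (- y) > 0"
      using c by (auto intro: add_pos_pos)
    then show "(f has_real_derivative f' y) (at y)"
      unfolding f_def f'_def by (auto intro!: derivative_eq_intros)
  next
    fix y y' :: real
    assume y: "y \<in> {0..}" "y' \<in> {0..}" "y \<le> y'"
    define e e' where "e = exp (- y)" and "e' = exp (- y')"
    have e: "0 < e'" "e' \<le> e" "e \<le> 1"
      using y by (auto simp: e_def e'_def)
    have D: "c + e > 0" "1 + c * e > 0" "c + e' > 0" "1 + c * e' > 0"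
      using c e by (auto intro: add_pos_pos)
    \<comment> \<open>In this form the monotonicity of \<open>f'\<close> reduces to that of s / ((c
      + s) (1 + c s)), which increases on (0, 1].\<close>
    have f'_eq: "- s / (c + s) + c * s / (1 + c * s) = - ((1 - c\<^sup>2) * (s / ((c + s) * (1 + c * s))))"
      if "c + s > 0" "1 + c * s > 0" for s
      using that by (simp add: divide_simps) (simp add: algebra_simps power2_eq_square)
    have "e' * e \<le> 1"
      using e mult_mono[of e' 1 e 1] by simp
    then have "0 \<le> c * ((e - e') * (1 - e' * e))"
      using c e by simp
    then have "e' * ((c + e) * (1 + c * e)) \<le> e * ((c + e') * (1 + c * e'))"
      by (simp add: algebra_simps)
    then have "e' / ((c + e') * (1 + c * e')) \<le> e / ((c + e) * (1 + c * e))"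
      using D by (simp add: divide_simps mult_ac)
    moreover have "0 \<le> 1 - c\<^sup>2"
      using c by (simp add: power_le_one)
    ultimately have "(1 - c\<^sup>2) * (e' / ((c + e') * (1 + c * e'))) \<le> (1 - c\<^sup>2) * (e / ((c + e) * (1 + c * e)))"
      by (rule mult_left_mono)
    then show "f' y \<le> f' y'"
      unfolding f'_def e_def[symmetric] e'_def[symmetric] using f'_eq D by simp
  qed simp
  moreover define Y where "Y = - ln r"
  moreover define y where "y = - ln \<rho>"
  moreover have Y: "Y > 0" and y: "0 \<le> y" "y \<le> Y"
    using r \<rho> by (auto simp: Y_def y_def)
  ultimately have "f ((1 - y / Y) *\<^sub>R 0 + (y / Y) *\<^sub>R Y) \<le> (1 - y / Y) * f 0 + y / Y * f Y"
    by (intro convex_onD divide_nonneg_pos) auto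
  moreover have "f 0 = 0"
    by (simp add: f_def add.commute)
  ultimately have fy: "f y \<le> y / Y * f Y"
    using Y by simp
  have fY: "f Y = ln ((c + r) / (1 + c * r))" and fy': "f y = ln ((c + \<rho>) / (1 + c * \<rho>))"
    unfolding Y_def y_def using r \<rho> by (auto intro!: f_ln)
  show neg: "ln ((c + r) / (1 + c * r)) < 0"
  proof -
    have "(1 - c) * (1 - r) > 0"
      using c r by simp
    then have "c + r < 1 + c * r"
      by (simp add: algebra_simps)
    then show ?thesis
      using c r by (subst ln_less_zero_iff) (auto simp: add_pos_pos)
  qed
  have "ln r / f Y \<ge> 0"
    using neg r unfolding fY by (simp add: divide_nonpos_neg)
  then have "ln r / f Y * f y \<le> ln r / f Y * (y / Y * f Y)"
    using fy by (rule mult_left_mono[rotated])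
  also have "\<dots> = ln \<rho>"
    using neg Y unfolding fY[symmetric] by (simp add: Y_def y_def)
  finally show "ln r / ln ((c + r) / (1 + c * r)) * ln ((c + \<rho>) / (1 + c * \<rho>)) \<le> ln \<rho>"
    unfolding fY fy' .
qed

text \<open>All follows from |1 - c z|^2 - |c - z|^2 = (1 - c^2) (1 - |z|^2) and |1 - c z| >= 1 - c
  |z|: together they give | |z| - c | <= \<rho> (1 - c |z|).\<close>

lemma pseudohyperbolic_triangle:
  fixes c :: real and z :: complex
  assumes c: "0 < c" "c < 1" and z: "cmod z \<le> 1"
  defines "\<rho> \<equiv> cmod (of_real c - z) / cmod (1 - of_real c * z)"
  shows "\<rho> \<le> 1" and "cmod z \<le> (c + \<rho>) / (1 + c * \<rho>)" and "cmod (1 - of_real c * z) > 0"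
proof -
  define N where "N = cmod (1 - of_real c * z)"
  have cz: "c * cmod z < 1"
    using c mult_left_mono[OF z, of c] by linarith
  have N: "N \<ge> 1 - c * cmod z"
    using norm_triangle_ineq2[of 1 "of_real c * z"] c by (simp add: N_def norm_mult)
  then show pos: "cmod (1 - of_real c * z) > 0"
    using cz unfolding N_def by linarith
  have id: "N\<^sup>2 - (cmod (of_real c - z))\<^sup>2 = (1 - c\<^sup>2) * (1 - (cmod z)\<^sup>2)"
    unfolding N_def cmod_power2 by (simp add: power2_eq_square algebra_simps)
  have nn: "0 \<le> (1 - c\<^sup>2) * (1 - (cmod z)\<^sup>2)"
    using c z by (intro mult_nonneg_nonneg) (auto simp: power_le_one)
  with id have "(cmod (of_real c - z))\<^sup>2 \<le> N\<^sup>2"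
    by linarith
  then have "cmod (of_real c - z) \<le> N"
    by (rule power2_le_imp_le) (simp add: N_def)
  then show "\<rho> \<le> 1"
    using pos by (simp add: \<rho>_def N_def)
  have \<rho>0: "\<rho> \<ge> 0"
    by (simp add: \<rho>_def)
  have d: "cmod (of_real c - z) = \<rho> * N"
    using pos by (simp add: \<rho>_def N_def)
  have "(cmod z - c)\<^sup>2 \<le> (\<rho> * (1 - c * cmod z))\<^sup>2"
  proof -
    have eq: "N\<^sup>2 * (1 - \<rho>\<^sup>2) = (1 - c\<^sup>2) * (1 - (cmod z)\<^sup>2)"
      using id unfolding d by (simp add: algebra_simps power_mult_distrib)
    have "(1 - c * cmod z)\<^sup>2 * (1 - \<rho>\<^sup>2) \<le> N\<^sup>2 * (1 - \<rho>\<^sup>2)"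
      using N cz \<rho>0 \<open>\<rho> \<le> 1\<close> by (intro mult_right_mono power_mono) (auto simp: power_le_one)
    then show ?thesis
      unfolding eq by (simp add: algebra_simps power2_eq_square)
  qed
  then have "cmod z - c \<le> \<rho> * (1 - c * cmod z)"
    using \<rho>0 cz by (intro power2_le_imp_le[where x = "cmod z - c"]) auto
  moreover have "1 + c * \<rho> > 0"
    using c \<rho>0 by (simp add: add_pos_nonneg)
  ultimately show "cmod z \<le> (c + \<rho>) / (1 + c * \<rho>)"
    by (simp add: le_divide_eq algebra_simps)
qed

section \<open>Product estimates at the point c\<close>

context sendov_counterexample
begin

text \<open>At y = 1/c, |1 - c v| is c |y - v|, and P'/P is a sum of n terms of modulus at most c /
  (1 - c). The factor n cancels against the leading coefficient of P'.\<close>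

lemma prod_zeros_ge_prod_critical:
  assumes c: "0 < c" "c < 1"
  shows "(\<Prod>k<n. cmod (1 - of_real c * z k)) \<ge> (1 - c) * (\<Prod>j<n - 1. cmod (1 - of_real c * w j))"
proof -
  define y where "y = complex_of_real (1 / c)"
  have scale: "cmod (1 - of_real c * v) = c * cmod (y - v)" for v
  proof -
    have "1 - of_real c * v = of_real c * (y - v)"
      using c by (simp add: y_def algebra_simps)
    then show ?thesis
      using c by (simp add: norm_mult)
  qed
  have far: "cmod (y - z k) \<ge> (1 - c) / c" if "k < n" for k
  proof -
    have "cmod (y - z k) \<ge> cmod y - cmod (z k)"
      by (rule norm_triangle_ineq2)
    moreover have "cmod y = 1 / c"
      unfolding y_def norm_of_real using c by simp
    ultimately show ?thesis
      using z_le[OF that] c by (simp add: diff_divide_distrib)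
  qed
  have "real n * (\<Prod>j<n - 1. cmod (y - w j)) = cmod (poly (pderiv P) y)"
    by (simp add: P' poly_prod norm_mult prod_norm)
  also have "poly (pderiv P) y = poly P y * (\<Sum>k<n. 1 / (y - z k))"
  proof -
    have "y \<noteq> z k" if "k < n" for k
      using far[OF that] c by (auto simp: divide_le_0_iff)
    then show ?thesis
      unfolding P by (intro poly_pderiv_prod_linear) auto
  qed
  also have "cmod (poly P y * (\<Sum>k<n. 1 / (y - z k))) \<le> cmod (poly P y) * (\<Sum>k<n. c / (1 - c))"
  proof -
    have "cmod (1 / (y - z k)) \<le> c / (1 - c)" if "k < n" for k
    proof -
      have "1 / cmod (y - z k) \<le> 1 / ((1 - c) / c)"
        using far[OF that] c by (intro frac_le) auto
      then show ?thesis
        by (simp add: norm_divide)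
    qed
    then have "cmod (\<Sum>k<n. 1 / (y - z k)) \<le> (\<Sum>k<n. c / (1 - c))"
      by (intro sum_norm_le) auto
    then show ?thesis
      by (simp only: norm_mult) (rule mult_left_mono, auto)
  qed
  also have "\<dots> = real n * ((\<Prod>k<n. cmod (y - z k)) * (c / (1 - c)))"
    by (simp add: P poly_prod prod_norm)
  finally have "(\<Prod>j<n - 1. cmod (y - w j)) \<le> (\<Prod>k<n. cmod (y - z k)) * (c / (1 - c))"
    using n by (subst (asm) mult_le_cancel_left_pos) auto
  then have "(1 - c) * (\<Prod>j<n - 1. cmod (y - w j)) \<le> c * (\<Prod>k<n. cmod (y - z k))"
    using c by (simp add: field_simps)
  then have "c ^ (n - 1) * ((1 - c) * (\<Prod>j<n - 1. cmod (y - w j)))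
      \<le> c ^ (n - 1) * (c * (\<Prod>k<n. cmod (y - z k)))"
    using c by (intro mult_left_mono) auto
  also have "\<dots> = c ^ n * (\<Prod>k<n. cmod (y - z k))"
    using n by (cases n) simp_all
  finally show ?thesis
    unfolding scale by (simp add: prod.distrib algebra_simps)
qed

text \<open>The affine bound on the lune is summed over the critical points; as the slope
  \<open>l\<close> is nonnegative, \<open>sum_Re_w_le\<close> bounds the sum below.\<close>

lemma prod_critical_ge:
  assumes E: "exp (- (real n * a\<^sup>2 / 32)) \<le> a\<^sup>2 / 40"
    and c: "0 < c" "c < 1" and l: "0 \<le> l"
      "l * (1 - a / 2) \<le> ln (1 + c - a * c) - ln (1 + c\<^sup>2 - a * c) / 2"
      "l * (1 + a / 2) \<le> ln (1 + c) - ln (1 + c\<^sup>2 - a * c) / 2"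
  shows "exp (ln (1 + c\<^sup>2 - a * c) / 2 + l * (a / 4)) ^ (n - 1)
           \<le> (\<Prod>j<n - 1. cmod (1 - of_real c * w j))"
proof -
  define m where "m = ln (1 + c\<^sup>2 - a * c) / 2"
  have pointwise: "exp (m + l * (a / 2 - Re (w j))) \<le> cmod (1 - of_real c * w j)" if j: "j < n - 1" for j
  proof -
    have "m + l * (a / 2 - Re (w j)) \<le> ln (cmod (1 - of_real c * w j))"
      unfolding m_def using c a w_le[OF j] w_far[OF j] Re_w_le[OF j] l by (intro ln_norm_lune_ge) auto
    then show ?thesis
      using pseudohyperbolic_triangle(3)[OF c w_le[OF j]] by (simp add: ln_ge_iff)
  qed
  have "exp (m + l * (a / 4)) ^ (n - 1) = exp (real (n - 1) * m + l * (real (n - 1) * (a / 4)))"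
    by (simp add: algebra_simps flip: exp_of_nat_mult)
  also have "\<dots> \<le> exp (real (n - 1) * m + l * (real (n - 1) * (a / 2) - (\<Sum>j<n - 1. Re (w j))))"
  proof -
    have "real (n - 1) * (a / 4) \<le> real (n - 1) * (a / 2) - (\<Sum>j<n - 1. Re (w j))"
      using sum_Re_w_le[OF E] by (simp add: field_simps)
    from mult_left_mono[OF this l(1)] show ?thesis
      by simp
  qed
  also have "\<dots> = exp (\<Sum>j<n - 1. m + l * (a / 2 - Re (w j)))"
    by (simp add: sum.distrib sum_subtractf right_diff_distrib sum_distrib_left)
  also have "\<dots> = (\<Prod>j<n - 1. exp (m + l * (a / 2 - Re (w j))))"
    by (simp add: exp_sum)
  also have "\<dots> \<le> (\<Prod>j<n - 1. cmod (1 - of_real c * w j))"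
    using pointwise by (intro prod_mono) auto
  finally show ?thesis
    by (simp add: m_def)
qed

text \<open>Zeros avoid the lens and hence the disc of radius \<open>r\<close>, so the chord
  estimate gives ln \<rho>_k >= q ln |z_k| for each k. The sum is controlled by the product of the
  |z_k|.\<close>

lemma prod_pseudohyperbolic_ge:
  assumes E: "exp (- (real n * a\<^sup>2 / 32)) \<le> a\<^sup>2 / 40" and c: "0 < c" "c < a"
  defines "r \<equiv> c * (a - c) / (2 * (1 - c\<^sup>2))"
  shows "r powr (ln (a / 16) / ln ((c + r) / (1 + c * r)))
           \<le> (\<Prod>k\<in>{1..<n}. cmod (of_real c - z k) / cmod (1 - of_real c * z k))"
proof -
  define \<rho> where "\<rho> k = cmod (of_real c - z k) / cmod (1 - of_real c * z k)" for k
  have c1: "c < 1"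
    using c a by simp
  have c2: "c\<^sup>2 < 1"
    using c c1 by (simp add: power_less_one_iff)
  have r0: "r > 0"
    using c c2 by (simp add: r_def)
  have r1: "r < 1"
  proof -
    have "c * (a - c) < 1 * (1 - c)"
      using c c1 a by (intro mult_strict_mono) auto
    also have "\<dots> \<le> 2 * (1 - c\<^sup>2)"
      using c c1 mult_left_mono[of 1 "2 * (1 + c)" "1 - c"] by (simp add: power2_eq_square algebra_simps)
    finally show ?thesis
      using c2 by (simp add: r_def divide_less_eq)
  qed
  have \<rho>r: "\<rho> k \<ge> r" if "k < n" for k
  proof (rule ccontr)
    assume "\<not> ?thesis"
    then have "cmod (z k - of_real c) < r * cmod (1 - of_real c * z k)"
      using pseudohyperbolic_triangle(3)[OF c(1) c1 z_le[OF that]]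
      by (simp add: \<rho>_def divide_less_eq norm_minus_commute not_le)
    then have "poly P (z k) \<noteq> 0"
      unfolding r_def using c a by (intro zero_not_in_lens pseudohyperbolic_disc_in_lens) auto
    then show False
      using that by (auto simp: P poly_prod)
  qed
  define q where "q = ln r / ln ((c + r) / (1 + c * r))"
  have q0: "q \<ge> 0"
    using ln_moebius_chord(2)[OF c(1) c1 r0 r1, of 1] r0 r1 by (simp add: q_def divide_nonpos_neg)
  have zprod_pos: "(\<Prod>k\<in>{1..<n}. cmod (z k)) > 0"
    using prod_zeros_ge[OF E] a by linarith
  have zpos: "cmod (z k) > 0" if "k \<in> {1..<n}" for k
    using zprod_pos that by (auto simp: less_le)
  \<comment> \<open>Exchanging the numerators shows that r^\<alpha> is (a/16)^q.\<close>
  have "ln r * (ln (a / 16) / ln ((c + r) / (1 + c * r))) = q * ln (a / 16)"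
    by (simp add: q_def)
  also have "\<dots> \<le> q * ln (\<Prod>k\<in>{1..<n}. cmod (z k))"
    using q0 prod_zeros_ge[OF E] a zprod_pos by (intro mult_left_mono) (auto simp: ln_le_cancel_iff)
  also have "\<dots> = (\<Sum>k\<in>{1..<n}. q * ln (cmod (z k)))"
    using zpos by (subst ln_prod) (auto simp: sum_distrib_left)
  also have "\<dots> \<le> (\<Sum>k\<in>{1..<n}. ln (\<rho> k))"
  proof (rule sum_mono)
    fix k
    assume k: "k \<in> {1..<n}"
    then have kn: "k < n"
      by simp
    note tri = pseudohyperbolic_triangle[OF c(1) c1 z_le[OF kn]]
    have "q * ln (cmod (z k)) \<le> q * ln ((c + \<rho> k) / (1 + c * \<rho> k))"
      using tri(2) zpos[OF k] q0 by (intro mult_left_mono ln_mono) (auto simp: \<rho>_def)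
    also have "\<dots> \<le> ln (\<rho> k)"
      unfolding q_def using tri(1) \<rho>r[OF kn] c c1 r0 r1
      by (intro ln_moebius_chord(1)) (auto simp: \<rho>_def)
    finally show "q * ln (cmod (z k)) \<le> ln (\<rho> k)" .
  qed
  also have "\<dots> = ln (\<Prod>k\<in>{1..<n}. \<rho> k)"
    using less_le_trans[OF r0 \<rho>r] by (subst ln_prod) force+
  finally have "ln r * (ln (a / 16) / ln ((c + r) / (1 + c * r))) \<le> ln (\<Prod>k\<in>{1..<n}. \<rho> k)" .
  moreover have "(\<Prod>k\<in>{1..<n}. \<rho> k) > 0"
    using less_le_trans[OF r0 \<rho>r] by (intro prod_pos) auto
  ultimately have "exp (ln r * (ln (a / 16) / ln ((c + r) / (1 + c * r)))) \<le> (\<Prod>k\<in>{1..<n}. \<rho> k)"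
    by (simp only: ln_ge_iff)
  then show ?thesis
    using r0 by (simp only: powr_def \<rho>_def mult.commute) simp
qed

text \<open>The zero \<open>a\<close> is split off: it contributes a - c to |P(c)| and 1 - a c to
  the product of the |1 - c z_k|, which explains the rational prefactor.\<close>

lemma poly_P_lower_bound:
  assumes E: "exp (- (real n * a\<^sup>2 / 32)) \<le> a\<^sup>2 / 40" and c: "0 < c" "c < a"
    and K: "0 \<le> K" "K \<le> exp (ln (1 + c\<^sup>2 - a * c) / 2 + l * (a / 4))"
    and l: "0 \<le> l"
      "l * (1 - a / 2) \<le> ln (1 + c - a * c) - ln (1 + c\<^sup>2 - a * c) / 2"
      "l * (1 + a / 2) \<le> ln (1 + c) - ln (1 + c\<^sup>2 - a * c) / 2"
  defines "r \<equiv> c * (a - c) / (2 * (1 - c\<^sup>2))"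
  shows "(1 - c) * (a - c) / (1 - a * c) * r powr (ln (a / 16) / ln ((c + r) / (1 + c * r))) * K ^ (n - 1)
           \<le> cmod (poly P (of_real c))"
proof -
  define R where "R = r powr (ln (a / 16) / ln ((c + r) / (1 + c * r)))"
  have c1: "c < 1"
    using c a by simp
  have ac: "a * c < 1"
    using a c c1 mult_strict_mono[of a 1 c 1] by simp
  define B Q where "B = (\<Prod>k\<in>{1..<n}. cmod (of_real c - z k) / cmod (1 - of_real c * z k))"
    and "Q = (\<Prod>k\<in>{1..<n}. cmod (1 - of_real c * z k))"
  have split: "{..<n} = insert 0 {1..<n}"
    using n by auto
  have R: "0 \<le> R" "R \<le> B"
    unfolding R_def B_def r_def using prod_pseudohyperbolic_ge[OF E c] by simp_all
  have "(1 - c) * K ^ (n - 1) \<le> (1 - c) * (\<Prod>j<n - 1. cmod (1 - of_real c * w j))"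
    using c1 K power_mono[OF K(2,1), of "n - 1"] prod_critical_ge[OF E c(1) c1 l]
    by (intro mult_left_mono) auto
  also have "\<dots> \<le> (\<Prod>k<n. cmod (1 - of_real c * z k))"
    by (rule prod_zeros_ge_prod_critical[OF c(1) c1])
  also have "\<dots> = (1 - a * c) * Q"
  proof -
    have "1 - of_real c * of_real a = complex_of_real (1 - a * c)"
      by simp
    then have "cmod (1 - of_real c * of_real a) = 1 - a * c"
      using ac by (simp only: norm_of_real)
    then show ?thesis
      unfolding split by (simp add: Q_def z0)
  qed
  finally have Q: "(1 - c) / (1 - a * c) * K ^ (n - 1) \<le> Q"
    using ac by (simp add: divide_le_eq mult.commute)
  have "(1 - c) * (a - c) / (1 - a * c) * R * K ^ (n - 1) = (a - c) * (R * ((1 - c) / (1 - a * c) * K ^ (n - 1)))"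
    by simp
  also have "\<dots> \<le> (a - c) * (B * Q)"
    using R Q c c1 ac K by (intro mult_left_mono mult_mono) auto
  also have "B * Q = (\<Prod>k\<in>{1..<n}. cmod (of_real c - z k))"
    unfolding B_def Q_def prod.distrib[symmetric]
    using pseudohyperbolic_triangle(3)[OF c(1) c1 z_le] by (intro prod.cong) auto
  also have "(a - c) * \<dots> = cmod (poly P (of_real c))"
  proof -
    have "cmod (of_real c - of_real a) = a - c"
      unfolding of_real_diff[symmetric] norm_of_real using c by simp
    moreover have "cmod (poly P (of_real c)) = (\<Prod>k<n. cmod (of_real c - z k))"
      by (simp add: P poly_prod prod_norm)
    ultimately show ?thesis
      unfolding split by (simp add: z0)
  qed
  finally show ?thesis
    unfolding R_def .
qed

end

section \<open>Translation from the definitions and conclusion\<close>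

lemma sendov_counterexample_zeros:
  assumes contra: "contradicts_sendov a zs n" and n: "n \<ge> 2"
  shows "\<exists>w. sendov_counterexample a n (\<lambda>k. if k = 0 then of_real a else zs k) w (sendov_poly a zs n)"
proof -
  define z where "z = (\<lambda>k. if k = 0 then complex_of_real a else zs k)"
  define P where "P = sendov_poly a zs n"
  have split: "{..<n} = insert 0 {1..n - 1}"
    using n by auto
  have P: "P = (\<Prod>k<n. [:- z k, 1:])"
    unfolding P_def sendov_poly_def split by (simp add: z_def)
  have deg: "degree P = n"
    unfolding P by (subst degree_prod_sum_eq) auto
  have lead: "lead_coeff P = 1"
    unfolding P by (simp add: lead_coeff_prod)
  have deg': "degree (pderiv P) = n - 1"
    by (simp add: degree_pderiv deg)
  have "lead_coeff (pderiv P) = of_nat n"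
    using lead n unfolding deg' deg by (simp add: coeff_pderiv)
  moreover obtain w where "smult (lead_coeff (pderiv P)) (\<Prod>i<degree (pderiv P). [:- w i, 1:]) = pderiv P"
    by (rule complex_poly_decompose')
  ultimately have P': "pderiv P = smult (of_nat n) (\<Prod>j<n - 1. [:- w j, 1:])"
    by (simp add: deg')
  have "sendov_counterexample a n z w P"
  proof
    show "cmod (z k) \<le> 1" if "k < n" for k
      using contra that by (auto simp: contradicts_sendov_def z_def)
    show "1 < cmod (w j - of_real a)" if "j < n - 1" for j
    proof -
      have "poly (pderiv P) (w j) = 0"
        unfolding P' using that by (auto simp: poly_prod)
      with contra show ?thesis
        by (simp add: contradicts_sendov_def P_def)
    qed
  qed (use contra n P P' in \<open>auto simp: contradicts_sendov_def z_def\<close>)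
  then show ?thesis
    unfolding z_def P_def by blast
qed

text \<open>The slope \<open>l\<close> is the largest one allowed by both constraints. The exponents
  \<open>p'\<close> and \<open>q'\<close> are a/4 divided by 1 - a/2 and 1 + a/2, so the two terms
  of \<open>K'\<close> are the exponentials belonging to the two extremal slopes, and their minimum
  belongs to the smaller slope.\<close>

lemma K'_le_exp:
  fixes a :: real
  assumes a: "0 < a" "a < 1" and c: "0 < cc a" "cc a < 1"
  obtains l where "0 \<le> l"
    and "l * (1 - a / 2) \<le> ln (1 + cc a - a * cc a) - ln (1 + (cc a)\<^sup>2 - a * cc a) / 2"
    and "l * (1 + a / 2) \<le> ln (1 + cc a) - ln (1 + (cc a)\<^sup>2 - a * cc a) / 2"
    and "0 \<le> K' a" and "K' a \<le> exp (ln (1 + (cc a)\<^sup>2 - a * cc a) / 2 + l * (a / 4))"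
proof -
  define c where "c = cc a"
  define S where "S = 1 + c\<^sup>2 - a * c"
  define m where "m = ln S / 2"
  have c: "0 < c" "c < 1"
    using c by (simp_all add: c_def)
  have ac: "a * c < 1" "0 < a * c"
    using a c mult_strict_mono[of a 1 c 1] by auto
  have S: "S > 0"
    using ac zero_le_power2[of c] unfolding S_def by linarith
  have T: "1 + c - a * c > 0"
    using ac c by linarith
  define l1 l2 where "l1 = (ln (1 + c - a * c) - m) / (1 - a / 2)" and "l2 = (ln (1 + c) - m) / (1 + a / 2)"
  define l where "l = min l1 l2"
  have m1: "m \<le> ln (1 + c - a * c)"
  proof -
    have "(1 + c - a * c)\<^sup>2 - S = c * ((2 - a) * (1 - a * c))"
      by (simp add: S_def power2_eq_square algebra_simps)
    also have "\<dots> \<ge> 0"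
      using a c ac by simp
    finally have "ln S \<le> ln ((1 + c - a * c)\<^sup>2)"
      using S by (intro ln_mono) auto
    also have "\<dots> = 2 * ln (1 + c - a * c)"
      using T by (simp add: ln_realpow)
    finally show ?thesis
      by (simp add: m_def)
  qed
  also have m2: "ln (1 + c - a * c) \<le> ln (1 + c)"
    using T ac by (intro ln_mono) auto
  finally have "m \<le> ln (1 + c)" .
  with m1 have l0: "0 \<le> l"
    using a by (simp add: l_def l1_def l2_def)
  have la: "l * (1 - a / 2) \<le> ln (1 + c - a * c) - m"
  proof -
    have "l * (1 - a / 2) \<le> l1 * (1 - a / 2)"
      using a by (intro mult_right_mono) (auto simp: l_def)
    then show ?thesis
      using a by (simp add: l1_def)
  qed
  have lb: "l * (1 + a / 2) \<le> ln (1 + c) - m"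
  proof -
    have "l * (1 + a / 2) \<le> l2 * (1 + a / 2)"
      using a by (intro mult_right_mono) (auto simp: l_def)
    then show ?thesis
      using a by (simp add: l2_def)
  qed
  have powr: "X powr p * sqrt S powr (1 - p) = exp (m + p * (ln X - m))" if "X > 0" for X p
    using that S by (simp add: powr_def m_def ln_sqrt field_simps flip: exp_add)
  have "(1 + c - a * c) powr p' a * sqrt S powr (1 - p' a) = exp (m + l1 * (a / 4))"
    unfolding powr[OF T] by (simp add: p'_def l1_def)
  moreover have "(1 + c) powr q' a * sqrt S powr (1 - q' a) = exp (m + l2 * (a / 4))"
    using powr[of "1 + c"] c by (simp add: q'_def l2_def)
  ultimately have K: "K' a = min (exp (m + l1 * (a / 4))) (exp (m + l2 * (a / 4)))"
    by (simp add: K'_def c_def S_def)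
  show thesis
  proof (rule that[of l])
    show "K' a \<le> exp (ln (1 + (cc a)\<^sup>2 - a * cc a) / 2 + l * (a / 4))"
      unfolding c_def[symmetric] S_def[symmetric] m_def[symmetric] K l_def by (simp add: min_def)
  qed (use l0 la lb K in \<open>simp_all add: c_def S_def m_def\<close>)
qed

theorem mainTheorem11:
  fixes a :: real and zs :: "nat \<Rightarrow> complex" and n :: nat
  assumes "0 < a" and "a < 1"
    and "contradicts_sendov a zs n"
    and "real n \<ge> N1 a"
  shows "cmod (poly (sendov_poly a zs n) (complex_of_real (cc a)))
           \<ge> (1 - cc a) * (a - cc a) / (1 - a * cc a) * (rr a) powr (alph a) * (K' a) ^ (n - 1)"
proof -
  have a2: "a\<^sup>2 > 0" "a\<^sup>2 < 1"
    using assms(1,2) by (simp_all add: power_less_one_iff)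
  have N0: "32 * ln (40 / a\<^sup>2) / a\<^sup>2 \<le> real n"
    using assms(4) by (simp add: N1_def N0_def)
  have "n \<ge> 2"
  proof -
    have "(4 + 2 * a) / a \<ge> 1"
      using assms(1) by (simp add: le_divide_eq)
    then have "9 * ((4 + 2 * a) / a)\<^sup>2 \<ge> 9 * 1"
      by (intro mult_left_mono one_le_power) auto
    with assms(4) have "real n \<ge> 9"
      by (simp add: N1_def)
    then show ?thesis
      by linarith
  qed
  then obtain w where "sendov_counterexample a n (\<lambda>k. if k = 0 then of_real a else zs k) w (sendov_poly a zs n)"
    using sendov_counterexample_zeros[OF assms(3)] by blast
  then interpret sendov_counterexample a n "\<lambda>k. if k = 0 then of_real a else zs k" w "sendov_poly a zs n" .
  \<comment> \<open>This is the condition n >= N0(a), exponentiated.\<close>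
  have E: "exp (- (real n * a\<^sup>2 / 32)) \<le> a\<^sup>2 / 40"
  proof -
    have "ln (40 / a\<^sup>2) \<le> real n * a\<^sup>2 / 32"
      using N0 a2 by (simp add: divide_le_eq)
    then have "exp (- (real n * a\<^sup>2 / 32)) \<le> exp (- ln (40 / a\<^sup>2))"
      by simp
    also have "\<dots> = a\<^sup>2 / 40"
      using a2 by (simp add: exp_minus)
    finally show ?thesis .
  qed
  have c: "0 < cc a" "cc a < a"
    using a by (simp_all add: cc_def gam_def)
  then have "cc a < 1"
    using a by simp
  with a c(1) obtain l where l: "0 \<le> l"
      "l * (1 - a / 2) \<le> ln (1 + cc a - a * cc a) - ln (1 + (cc a)\<^sup>2 - a * cc a) / 2"
      "l * (1 + a / 2) \<le> ln (1 + cc a) - ln (1 + (cc a)\<^sup>2 - a * cc a) / 2"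
    and K: "0 \<le> K' a" "K' a \<le> exp (ln (1 + (cc a)\<^sup>2 - a * cc a) / 2 + l * (a / 4))"
    by (rule K'_le_exp)
  from poly_P_lower_bound[OF E c K l] show ?thesis
    unfolding rr_def alph_def .
qed

end
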